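(* Let $\alpha\in(0,1)$, let $g:\mathbb{T}^N\to\mathbb{R}$ be Lipschitz continuous, and let $H(x,p)=F(x,p)-f(x)$ on $\mathbb{T}^N\times\mathbb{R}^N$, with $F,f$ continuous, such that: 1. $F(x,\cdot)$ is convex for all $x\in\mathbb{T}^N$; $F(x,p)>F(x,0)=0$ for all $x\in\mathbb{T}^N$, $p\in\mathbb{R}^N\setminus\{0\}$; $f\ge0$, $f$ is Lipschitz continuous, and $\min_{\mathbb{T}^N}f=0$. 2. There are $C_H>1$ and $m\ge1$ with $F(x,p)\ge C_H^{-1}|p|^m-C_H$ for all $x\in\mathbb{T}^N,p\in\mathbb{R}^N$. 3. At least one of the following holds: (A) there is $c_H>0$ with $|H(x,p)-H(y,p)|\le c_H(1+|p|)|x-y|$ for all $x,y\in\mathbb{T}^N$, $p\in\mathbb{R}^N$; (B) there are $m'>1$, $A>0$, $c_H>1$ such that for all $\mu\in(0,1)$, $x,y\in\mathbb{T}^N$, $p\in\mathbb{R}^N$: $\mu H(x,\mu^{-1}p)-H(x,p)\ge(1-\mu)(c_H^{-1}|p|^{m'}-A)$ and $|H(x,p)-H(y,p)|\le c_H(1+|p|^{m'})|x-y|$. 4. There exist $\nu,r>0$ and $k\ge1$ such that $F(x,p)\ge\nu|p|^k$ for all $x\in\mathbb{T}^N$, $p\in B(0,r)$. Set $Z=\{x\in\mathbb{T}^N: f(x)=\min_{\mathbb{T}^N}f\}=\{f=0\}$ and assume $\mathrm{argmin}\{g\}\cap Z\ne\emptyset$. Assume further that for each $z\in Z$ there exist $x_0\in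 Z\cap\mathrm{argmin}\{g\}$ and a rectifiable curve $\gamma:[0,1]\to\mathbb{T}^N$ such that $\gamma(0)=x_0$, $\gamma(1)=z$ and $\gamma(t)\in Z$ for all $t\in[0,1]$. Then the unique viscosity solution $u$ of $$\partial_t^\alpha u+F(x,Du)=f(x)\ \text{ in }\mathbb{T}^N\times(0,+\infty),\qquad u(\cdot,0)=g\ \text{ in }\mathbb{T}^N$$ satisfies: for every $x\in Z$, $u(x,t)\to\min_{\mathbb{T}^N}g$ as $t\to+\infty$.
   Context: $\mathbb{T}^N=\mathbb{R}^N/\mathbb{Z}^N$ is the flat torus, $|x-y|$ for $x,y\in\mathbb{T}^N$ is the periodic (quotient) distance, $Du$ is the gradient in $x$, and $\mathrm{argmin}\{g\}=\{x: g(x)=\min_{\mathbb{T}^N}g\}$. A continuous curve $\gamma:[0,1]\to\mathbb{T}^N$ is rectifiable if its length $\ell(\gamma)=\sup\sum_{i=1}^n|\gamma(t_i)-\gamma(t_{i-1})|$, the supremum being over all $n$ and $0=t_0<t_1<\dots<t_n=1$, is finite. Caputo derivative of order $\alpha\in(0,1)$ (normalizing constant taken equal to 1): a function $\phi$ on $[0,+\infty)$ is extended to $s<0$ by $\phi(s)=\phi(0)$ and, when the integral exists, $\partial_t^\alpha\phi(t)=\int_{-\infty}^t\frac{\phi(t)-\phi(s)}{|t-s|^{1+\alpha}}ds$, $t>0$. For $a<b\le t$ set $\partial_t^\alpha[a]\phi(t)=\int_{-\infty}^a\frac{\phi(t)-\phi(s)}{|t-s|^{1+\alpha}}ds$ and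 $\partial_t^\alpha[a,b]\phi(t)=\int_a^b\frac{\phi(t)-\phi(s)}{|t-s|^{1+\alpha}}ds$. Viscosity solutions: let $u$ be continuous on $\mathbb{T}^N\times[0,+\infty)$, extended by $u(x,s)=u(x,0)$ for $s<0$. $u$ is a viscosity subsolution (resp. supersolution) of $\partial_t^\alpha u+H(x,Du)=0$ in $\mathbb{T}^N\times(0,+\infty)$ if for every $(x_0,t_0)$ with $t_0>0$, every $\delta\in(0,t_0)$ and every $C^1$ function $\varphi$ such that $u-\varphi$ has a maximum (resp. minimum) at $(x_0,t_0)$ over $B_\delta(x_0)\times[t_0-\delta,t_0+\delta]$, one has $$\partial_t^\alpha[t_0-\delta]u(x_0,\cdot)(t_0)+\partial_t^\alpha[t_0-\delta,t_0]\varphi(x_0,\cdot)(t_0)+H(x_0,D\varphi(x_0,t_0))\le0\quad(\text{resp. }\ge0).$$ A viscosity solution is both a sub- and a supersolution. The initial condition is understood pointwise. *)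

theory Defs
  imports "HOL-Analysis.Analysis"
begin

section \<open>The flat torus\<close>

definition int_lattice :: "(real ^ 'n::finite) set" where
  "int_lattice = {k. \<forall>i. k $ i \<in> \<int>}"

lemma int_lattice_0 [simp]: "0 \<in> int_lattice"
  by (simp add: int_lattice_def)

lemma int_lattice_nonempty [simp]: "int_lattice \<noteq> {}"
  using int_lattice_0 by blast

lemma int_lattice_add: "a \<in> int_lattice \<Longrightarrow> b \<in> int_lattice \<Longrightarrow> a + b \<in> int_lattice"
  by (simp add: int_lattice_def)

lemma int_lattice_minus: "a \<in> int_lattice \<Longrightarrow> - a \<in> int_lattice"
  by (simp add: int_lattice_def)

lemma closed_int_lattice: "closed (int_lattice :: (real ^ 'n::finite) set)"
proof -
  have "closed {k :: real ^ 'n. k $ i \<in> \<int>}" for i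
    using continuous_closed_vimage[of "\<int>" "\<lambda>k :: real ^ 'n. k $ i"]
    by (simp add: vimage_def)
  then have "closed (\<Inter>i. {k :: real ^ 'n. k $ i \<in> \<int>})"
    by blast
  moreover have "int_lattice = (\<Inter>i. {k :: real ^ 'n. k $ i \<in> \<int>})"
    by (auto simp: int_lattice_def)
  ultimately show ?thesis
    by simp
qed

lemma infdist_int_lattice_add:
  fixes a b :: "real ^ 'n::finite"
  shows "infdist (a + b) int_lattice \<le> infdist a int_lattice + infdist b int_lattice"
proof -
  obtain k where k: "k \<in> int_lattice" "infdist a int_lattice = dist a k"
    using infdist_attains_inf[OF closed_int_lattice int_lattice_nonempty] by blast
  obtain l where l: "l \<in> int_lattice" "infdist b int_lattice = dist b l"
    using infdist_attains_inf[OF closed_int_lattice int_lattice_nonempty] by blast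
  have "infdist (a + b) int_lattice \<le> dist (a + b) (k + l)"
    by (intro infdist_le int_lattice_add k l)
  also have "\<dots> \<le> dist a k + dist b l"
    by (rule dist_triangle_add)
  finally show ?thesis
    by (simp add: k l)
qed

lemma infdist_int_lattice_minus:
  fixes a :: "real ^ 'n::finite"
  shows "infdist (- a) int_lattice = infdist a int_lattice"
proof -
  have *: "infdist (- a) int_lattice \<le> infdist a int_lattice" for a :: "real ^ 'n"
  proof -
    obtain k where k: "k \<in> int_lattice" "infdist a int_lattice = dist a k"
      using infdist_attains_inf[OF closed_int_lattice int_lattice_nonempty] by blast
    have "infdist (- a) int_lattice \<le> dist (- a) (- k)"
      by (intro infdist_le int_lattice_minus k)
    then show ?thesis
      by (simp add: k dist_minus)
  qed
  from *[of a] *[of "- a"] show ?thesis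
    by simp
qed

lemma infdist_int_lattice_cong:
  assumes "a - b \<in> int_lattice"
  shows "infdist a int_lattice = infdist b int_lattice"
proof -
  have "b - a \<in> int_lattice"
    using int_lattice_minus[OF assms] by simp
  with assms infdist_int_lattice_add[of "a - b" b] infdist_int_lattice_add[of "b - a" a]
  show ?thesis
    by simp
qed

quotient_type 'n torus = "real ^ 'n::finite" / "\<lambda>x y. x - y \<in> int_lattice"
  morphisms torus_rep to_torus
proof (rule equivpI)
  show "reflp (\<lambda>x y :: real ^ 'n. x - y \<in> int_lattice)"
    by (simp add: reflp_def)
  show "symp (\<lambda>x y :: real ^ 'n. x - y \<in> int_lattice)"
  proof (rule sympI)
    fix x y :: "real ^ 'n"
    assume "x - y \<in> int_lattice"
    from int_lattice_minus[OF this] show "y - x \<in> int_lattice"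
      by simp
  qed
  show "transp (\<lambda>x y :: real ^ 'n. x - y \<in> int_lattice)"
  proof (rule transpI)
    fix x y z :: "real ^ 'n"
    assume "x - y \<in> int_lattice" "y - z \<in> int_lattice"
    from int_lattice_add[OF this] show "x - z \<in> int_lattice"
      by simp
  qed
qed

text \<open>The quotient distance: \<open>|x - y|\<close> is the infimum of the Euclidean norms of
  \<open>x - y - k\<close> over all \<open>k \<in> \<int>\<^sup>N\<close>.\<close>

instantiation torus :: (finite) metric_space
begin

lift_definition dist_torus :: "'a torus \<Rightarrow> 'a torus \<Rightarrow> real"
  is "\<lambda>x y. infdist (x - y) int_lattice"
proof (rule infdist_int_lattice_cong)
  fix x x' y y' :: "real ^ 'a"
  assume "x - x' \<in> int_lattice" "y - y' \<in> int_lattice"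
  then have "(x - x') + - (y - y') \<in> int_lattice"
    by (intro int_lattice_add int_lattice_minus)
  then show "x - y - (x' - y') \<in> int_lattice"
    by (simp add: algebra_simps)
qed

definition uniformity_torus :: "('a torus \<times> 'a torus) filter" where
  "uniformity_torus = (INF e\<in>{0<..}. principal {(x, y). dist x y < e})"

definition open_torus :: "'a torus set \<Rightarrow> bool" where
  "open_torus U \<longleftrightarrow> (\<forall>x\<in>U. eventually (\<lambda>(x', y). x' = x \<longrightarrow> y \<in> U) uniformity)"

instance
proof
  fix x y z :: "'a torus"
  show "dist x y = 0 \<longleftrightarrow> x = y"
    by transfer (simp add: in_closed_iff_infdist_zero[OF closed_int_lattice int_lattice_nonempty])
  show "dist x y \<le> dist x z + dist y z"
  proof transfer
    fix x y z :: "real ^ 'a"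
    have "infdist ((x - z) + - (y - z)) int_lattice
        \<le> infdist (x - z) int_lattice + infdist (y - z) int_lattice"
      using infdist_int_lattice_add[of "x - z" "- (y - z)"]
      by (simp only: infdist_int_lattice_minus)
    then show "infdist (x - y) int_lattice
        \<le> infdist (x - z) int_lattice + infdist (y - z) int_lattice"
      by simp
  qed
qed (simp_all only: uniformity_torus_def open_torus_def)

end


section \<open>Minima and rectifiable curves\<close>

definition min_value :: "('a \<Rightarrow> real) \<Rightarrow> real" where
  "min_value g = (LEAST m. m \<in> range g)"

definition argmin :: "('a \<Rightarrow> real) \<Rightarrow> 'a set" where
  "argmin g = {x. g x = min_value g}"

definition curve_length :: "(real \<Rightarrow> 'a::metric_space) \<Rightarrow> ereal" where
  "curve_length \<gamma> =
    Sup {ereal (\<Sum>i = 1..n. dist (\<gamma> (t i)) (\<gamma> (t (i - 1)))) | (n :: nat) (t :: nat \<Rightarrow> real).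
      n \<ge> 1 \<and> t 0 = 0 \<and> t n = 1 \<and> (\<forall>i\<in>{1..n}. t (i - 1) < t i)}"

definition rectifiable_curve :: "(real \<Rightarrow> 'a::metric_space) \<Rightarrow> bool" where
  "rectifiable_curve \<gamma> \<longleftrightarrow> continuous_on {0..1} \<gamma> \<and> curve_length \<gamma> < \<infinity>"


section \<open>Differentiation on the torus\<close>

text \<open>Derivatives of a function on the torus are those of its periodic lift to \<open>\<real>\<^sup>N\<close>.\<close>

definition torus_grad :: "('n::finite torus \<Rightarrow> real) \<Rightarrow> 'n torus \<Rightarrow> real ^ 'n" where
  "torus_grad \<psi> x =
    (THE p. \<forall>y. to_torus y = x \<longrightarrow> (GDERIV (\<lambda>z. \<psi> (to_torus z)) y :> p))"

text \<open>Continuous differentiability on the torus times \<open>(0, \<infinity>)\<close>, the domain of the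
  equation; values at nonpositive times are irrelevant.\<close>

definition C1_torus_time :: "('n::finite torus \<Rightarrow> real \<Rightarrow> real) \<Rightarrow> bool" where
  "C1_torus_time \<phi> \<longleftrightarrow>
    (\<exists>D :: (real ^ 'n) \<times> real \<Rightarrow> ((real ^ 'n) \<times> real) \<Rightarrow>\<^sub>L real.
      continuous_on (UNIV \<times> {0<..}) D \<and>
      (\<forall>z \<in> UNIV \<times> {0<..}.
        ((\<lambda>(y, t). \<phi> (to_torus y) t) has_derivative blinfun_apply (D z)) (at z)))"

lemma to_torus_eq_iff: "to_torus x = to_torus y \<longleftrightarrow> x - y \<in> int_lattice"
  by (rule torus.abs_eq_iff)

lemma GDERIV_torus_lift_cong:
  assumes "GDERIV (\<lambda>z. \<psi> (to_torus z)) y :> p" "to_torus y' = to_torus y"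
  shows "GDERIV (\<lambda>z. \<psi> (to_torus z)) y' :> p"
proof -
  define k where "k = y - y'"
  have k: "k \<in> int_lattice"
    using assms(2) unfolding k_def by (metis to_torus_eq_iff)
  have "((\<lambda>z. \<psi> (to_torus z)) has_derivative (\<lambda>h. h \<bullet> p)) (at (y' + k))"
    using assms(1) by (simp add: gderiv_def k_def)
  then have "((\<lambda>z. \<psi> (to_torus (z + k))) has_derivative (\<lambda>h. h \<bullet> p)) (at y')"
    by (rule has_derivative_compose[rotated]) (auto intro!: derivative_eq_intros)
  moreover have "to_torus (z + k) = to_torus z" for z
    using k by (simp add: to_torus_eq_iff)
  ultimately show ?thesis
    by (simp add: gderiv_def)
qed

lemma torus_grad_eqI:
  assumes "GDERIV (\<lambda>z. \<psi> (to_torus z)) y :> p"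
  shows "torus_grad \<psi> (to_torus y) = p"
  unfolding torus_grad_def
proof (rule the_equality)
  show "\<forall>y'. to_torus y' = to_torus y \<longrightarrow> (GDERIV (\<lambda>z. \<psi> (to_torus z)) y' :> p)"
    using GDERIV_torus_lift_cong[OF assms] by blast
next
  fix q
  assume "\<forall>y'. to_torus y' = to_torus y \<longrightarrow> (GDERIV (\<lambda>z. \<psi> (to_torus z)) y' :> q)"
  then have "(\<lambda>h. h \<bullet> q) = (\<lambda>h. h \<bullet> p)"
    using assms has_derivative_unique unfolding gderiv_def by blast
  then have "h \<bullet> q = h \<bullet> p" for h
    by meson
  then show "q = p"
    by (metis vector_eq_ldot)
qed


section \<open>Caputo derivative and viscosity solutions\<close>

definition past_extension :: "(real \<Rightarrow> real) \<Rightarrow> real \<Rightarrow> real" where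
  "past_extension \<phi> s = (if s < 0 then \<phi> 0 else \<phi> s)"

definition caputo_integrand :: "real \<Rightarrow> (real \<Rightarrow> real) \<Rightarrow> real \<Rightarrow> real \<Rightarrow> real" where
  "caputo_integrand \<alpha> \<phi> t s =
    (past_extension \<phi> t - past_extension \<phi> s) / \<bar>t - s\<bar> powr (1 + \<alpha>)"

definition caputo_upto :: "real \<Rightarrow> real \<Rightarrow> (real \<Rightarrow> real) \<Rightarrow> real \<Rightarrow> real" where
  "caputo_upto \<alpha> a \<phi> t = (LINT s:{..a}|lborel. caputo_integrand \<alpha> \<phi> t s)"

definition caputo_between :: "real \<Rightarrow> real \<Rightarrow> real \<Rightarrow> (real \<Rightarrow> real) \<Rightarrow> real \<Rightarrow> real" where
  "caputo_between \<alpha> a b \<phi> t = (LINT s:{a..b}|lborel. caputo_integrand \<alpha> \<phi> t s)"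

text \<open>The left-hand side of the equation at \<open>(x\<^sub>0, t\<^sub>0)\<close>, with the Caputo integral
  evaluated on \<open>u\<close> up to time \<open>t\<^sub>0 - \<delta>\<close> and on the test function after it.\<close>

definition viscosity_lhs ::
  "real \<Rightarrow> ('n::finite torus \<Rightarrow> real ^ 'n \<Rightarrow> real) \<Rightarrow> ('n torus \<Rightarrow> real \<Rightarrow> real) \<Rightarrow>
    ('n torus \<Rightarrow> real \<Rightarrow> real) \<Rightarrow> real \<Rightarrow> 'n torus \<Rightarrow> real \<Rightarrow> real" where
  "viscosity_lhs \<alpha> H u \<phi> \<delta> x0 t0 =
    caputo_upto \<alpha> (t0 - \<delta>) (u x0) t0 + caputo_between \<alpha> (t0 - \<delta>) t0 (\<phi> x0) t0
      + H x0 (torus_grad (\<lambda>x. \<phi> x t0) x0)"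

definition viscosity_subsolution ::
  "real \<Rightarrow> ('n::finite torus \<Rightarrow> real ^ 'n \<Rightarrow> real) \<Rightarrow> ('n torus \<Rightarrow> real \<Rightarrow> real) \<Rightarrow> bool" where
  "viscosity_subsolution \<alpha> H u \<longleftrightarrow>
    continuous_on (UNIV \<times> {0..}) (\<lambda>(x, t). u x t) \<and>
    (\<forall>x0 t0 \<delta> \<phi>. t0 > 0 \<longrightarrow> 0 < \<delta> \<longrightarrow> \<delta> < t0 \<longrightarrow> C1_torus_time \<phi> \<longrightarrow>
      (\<forall>x \<in> ball x0 \<delta>. \<forall>t \<in> {t0 - \<delta>..t0 + \<delta>}. u x t - \<phi> x t \<le> u x0 t0 - \<phi> x0 t0) \<longrightarrow>
      viscosity_lhs \<alpha> H u \<phi> \<delta> x0 t0 \<le> 0)"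

definition viscosity_supersolution ::
  "real \<Rightarrow> ('n::finite torus \<Rightarrow> real ^ 'n \<Rightarrow> real) \<Rightarrow> ('n torus \<Rightarrow> real \<Rightarrow> real) \<Rightarrow> bool" where
  "viscosity_supersolution \<alpha> H u \<longleftrightarrow>
    continuous_on (UNIV \<times> {0..}) (\<lambda>(x, t). u x t) \<and>
    (\<forall>x0 t0 \<delta> \<phi>. t0 > 0 \<longrightarrow> 0 < \<delta> \<longrightarrow> \<delta> < t0 \<longrightarrow> C1_torus_time \<phi> \<longrightarrow>
      (\<forall>x \<in> ball x0 \<delta>. \<forall>t \<in> {t0 - \<delta>..t0 + \<delta>}. u x t - \<phi> x t \<ge> u x0 t0 - \<phi> x0 t0) \<longrightarrow>
      viscosity_lhs \<alpha> H u \<phi> \<delta> x0 t0 \<ge> 0)"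

definition viscosity_solution ::
  "real \<Rightarrow> ('n::finite torus \<Rightarrow> real ^ 'n \<Rightarrow> real) \<Rightarrow> ('n torus \<Rightarrow> real \<Rightarrow> real) \<Rightarrow> bool" where
  "viscosity_solution \<alpha> H u \<longleftrightarrow>
    viscosity_subsolution \<alpha> H u \<and> viscosity_supersolution \<alpha> H u"

end

theory Submission
  imports Defs
begin

text \<open>
  Comparison with constants gives \<open>u \<ge> min g\<close>. At a zero \<open>z\<close> of \<open>f\<close>, penalizing the distance to
  \<open>z\<close> and using \<open>F \<ge> 0\<close> gives \<open>u(z, t) \<le> g(z)\<close>, hence \<open>u(x\<^sub>0, t) = min g\<close> for
  \<open>x\<^sub>0 \<in> Z \<inter> argmin g\<close>, and a steep cone with vertex \<open>x\<^sub>0\<close> bounds \<open>u\<close> uniformly in time.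
  Near \<open>Z\<close> the function \<open>f\<close> is smaller than \<open>inf {F(x, p) : |p| \<ge> \<epsilon>}\<close>, so a bound
  \<open>u(z, t) \<le> L\<close> for large \<open>t\<close> at a point \<open>z\<close> of \<open>Z\<close> propagates, with the barrier
  \<open>\<epsilon>|y - z| + M|y - z|\<^sup>2\<close>, to \<open>u(y, t) \<le> L + \<epsilon>|y - z| + M|y - z|\<^sup>2\<close> for large \<open>t\<close>, where \<open>M\<close>
  depends on \<open>\<epsilon>\<close> but not on \<open>z\<close>. Iterating along a fine partition of a curve of length \<open>l\<close> in \<open>Z\<close>
  yields \<open>limsup u(z, t) \<le> min g + 2 \<epsilon> l\<close> for every \<open>\<epsilon> > 0\<close>.
\<close>

section \<open>Lower bounds for Caputo integrals\<close>

text \<open>The reflection \<open>s = t - x\<close> turns this integral and the next into power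
  integrals. They are the mass of the Caputo kernel over the remote past and that of the kernel
  times a linear increment over the recent past.\<close>

lemma has_bochner_integral_powr_tail:
  fixes \<alpha> a t :: real
  assumes "0 < \<alpha>" "a < t"
  shows "has_bochner_integral lborel (\<lambda>s. indicator {..a} s * (1 / \<bar>t - s\<bar> powr (1 + \<alpha>)))
    ((t - a) powr (- \<alpha>) / \<alpha>)"
proof -
  let ?f = "\<lambda>x::real. x powr (- 1 - \<alpha>)"
  have "(?f has_integral ((t - a) powr (- \<alpha>) / \<alpha>)) {t - a..}"
    using has_integral_powr_to_inf[of "- 1 - \<alpha>" "t - a"] assms by simp
  then have "integral\<^sup>N lborel (\<lambda>x. indicator {t - a..} x * ?f x) = (t - a) powr (- \<alpha>) / \<alpha>"
    by (intro nn_integral_has_integral_lebesgue) auto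
  then have "has_bochner_integral lborel (\<lambda>x. indicator {t - a..} x * ?f x)
      ((t - a) powr (- \<alpha>) / \<alpha>)"
    using assms by (intro has_bochner_integral_nn_integral) auto
  then have "has_bochner_integral lborel (\<lambda>s. indicator {t - a..} (t + (- 1) * s) * ?f (t + (- 1) * s))
      (((t - a) powr (- \<alpha>) / \<alpha>) /\<^sub>R \<bar>- 1\<bar>)"
    by (subst (asm) lborel_has_bochner_integral_real_affine_iff[where c = "- 1" and t = t]) auto
  moreover have "indicator {t - a..} (t + (- 1) * s) * ?f (t + (- 1) * s) =
      indicator {..a} s * (1 / \<bar>t - s\<bar> powr (1 + \<alpha>))" for s
    using assms by (auto simp: indicator_def powr_minus_divide[symmetric])
  ultimately show ?thesis
    by simp
qed

lemma has_bochner_integral_powr_head: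
  fixes \<alpha> a t :: real
  assumes "\<alpha> < 1" "a \<le> t"
  shows "has_bochner_integral lborel (\<lambda>s. indicator {a..t} s * \<bar>t - s\<bar> powr (- \<alpha>))
    ((t - a) powr (1 - \<alpha>) / (1 - \<alpha>))"
proof -
  let ?f = "\<lambda>x::real. x powr (- \<alpha>)"
  have "(?f has_integral ((t - a) powr (1 - \<alpha>) / (1 - \<alpha>))) {0..t - a}"
    using has_integral_powr_from_0[of "- \<alpha>" "t - a"] assms by simp
  then have "integral\<^sup>N lborel (\<lambda>x. indicator {0..t - a} x * ?f x) =
      (t - a) powr (1 - \<alpha>) / (1 - \<alpha>)"
    by (intro nn_integral_has_integral_lebesgue) auto
  then have "has_bochner_integral lborel (\<lambda>x. indicator {0..t - a} x * ?f x)
      ((t - a) powr (1 - \<alpha>) / (1 - \<alpha>))"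
    using assms by (intro has_bochner_integral_nn_integral) auto
  then have "has_bochner_integral lborel (\<lambda>s. indicator {0..t - a} (t + (- 1) * s) * ?f (t + (- 1) * s))
      (((t - a) powr (1 - \<alpha>) / (1 - \<alpha>)) /\<^sub>R \<bar>- 1\<bar>)"
    by (subst (asm) lborel_has_bochner_integral_real_affine_iff[where c = "- 1" and t = t]) auto
  moreover have "indicator {0..t - a} (t + (- 1) * s) * ?f (t + (- 1) * s) =
      indicator {a..t} s * \<bar>t - s\<bar> powr (- \<alpha>)" for s
    by (auto simp: indicator_def)
  ultimately show ?thesis
    by simp
qed

text \<open>Composition with \<open>max 0\<close> makes continuity immediate and confines the values
  up to a given time to those on a compact interval.\<close>

lemma past_extension_eq_max: "past_extension v s = v (max 0 s)"
  by (simp add: past_extension_def max_def)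

lemma continuous_on_past_extension:
  assumes "continuous_on {0..} v"
  shows "continuous_on UNIV (past_extension v)"
  unfolding past_extension_eq_max
  by (rule continuous_on_compose2[OF assms]) (auto intro!: continuous_intros)

lemma caputo_integrand_uminus:
  "caputo_integrand \<alpha> (\<lambda>s. - v s) t s = - caputo_integrand \<alpha> v t s"
  by (simp add: caputo_integrand_def past_extension_def minus_divide_left)

lemma caputo_upto_uminus: "caputo_upto \<alpha> a (\<lambda>s. - v s) t = - caputo_upto \<alpha> a v t"
  by (simp add: caputo_upto_def caputo_integrand_uminus set_lebesgue_integral_def)

lemma caputo_between_uminus: "caputo_between \<alpha> a b (\<lambda>s. - v s) t = - caputo_between \<alpha> a b v t"
  by (simp add: caputo_between_def caputo_integrand_uminus set_lebesgue_integral_def)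

text \<open>The kernel is integrable away from \<open>t\<close>, and the extended past is bounded:
  continuous on a compact interval and constant before time 0.\<close>

lemma set_integrable_caputo_integrand:
  assumes "0 < \<alpha>" "a < t" "continuous_on {0..} v"
  shows "set_integrable lborel {..a} (caputo_integrand \<alpha> v t)"
proof -
  note cont = continuous_on_past_extension[OF assms(3)]
  have "compact (v ` {0..max 0 t})"
    by (intro compact_continuous_image continuous_on_subset[OF assms(3)]) auto
  then obtain P where "\<forall>y \<in> v ` {0..max 0 t}. norm y \<le> P"
    using compact_imp_bounded bounded_iff by metis
  then have P: "\<bar>v s\<bar> \<le> P" if "s \<in> {0..max 0 t}" for s
    using that by auto
  have P': "\<bar>past_extension v s\<bar> \<le> P" if "s \<le> t" for s
    unfolding past_extension_eq_max by (rule P) (use that in auto)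
  have "set_integrable lborel {..a} (\<lambda>s. 2 * P * (1 / \<bar>t - s\<bar> powr (1 + \<alpha>)))"
    using has_bochner_integral_powr_tail[OF assms(1,2)]
    by (intro set_integrable_mult_right) (auto simp: set_integrable_def has_bochner_integral_iff)
  then show ?thesis
  proof (rule set_integrable_bound)
    have "past_extension v \<in> borel_measurable borel"
      using cont by (rule borel_measurable_continuous_onI)
    then show "set_borel_measurable lborel {..a} (caputo_integrand \<alpha> v t)"
      unfolding set_borel_measurable_def caputo_integrand_def by measurable
    show "AE s in lborel. s \<in> {..a} \<longrightarrow>
        norm (caputo_integrand \<alpha> v t s) \<le> norm (2 * P * (1 / \<bar>t - s\<bar> powr (1 + \<alpha>)))"
    proof (intro AE_I2 impI)
      fix s assume "s \<in> {..a}"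
      then have "s \<le> t" using assms by auto
      with P'[of t] P'[of s]
      have "\<bar>past_extension v t - past_extension v s\<bar> \<le> \<bar>2 * P\<bar>" by auto
      then show "norm (caputo_integrand \<alpha> v t s) \<le> norm (2 * P * (1 / \<bar>t - s\<bar> powr (1 + \<alpha>)))"
        by (simp add: caputo_integrand_def abs_divide divide_right_mono)
    qed
  qed
qed

text \<open>The past is cut at \<open>a\<close>. Before \<open>a\<close> increments are at least
  \<open>b\<close>; after it they are at least \<open>- c * (t - s)\<close>, which leaves the
  integrable singularity \<open>\<bar>t - s\<bar> powr (- \<alpha>)\<close>. Its mass over all of
  \<open>{a..t}\<close> is charged once for \<open>v\<close> and once for \<open>\<theta>\<close>,
  hence the factor 2.\<close>

lemma caputo_lower_bound:
  fixes \<alpha> a b c t \<delta> :: real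
  assumes alpha: "0 < \<alpha>" "\<alpha> < 1"
    and a: "a \<le> t - \<delta>" "0 < \<delta>" "\<delta> < t" and c: "0 \<le> c"
    and v: "continuous_on {0..} v"
    and far: "\<And>s. s \<le> a \<Longrightarrow> b \<le> v t - past_extension v s"
    and near: "\<And>s. a < s \<Longrightarrow> s \<le> t - \<delta> \<Longrightarrow> - c * (t - s) \<le> v t - past_extension v s"
    and test: "\<And>s. t - \<delta> \<le> s \<Longrightarrow> s \<le> t \<Longrightarrow> - c * (t - s) \<le> \<theta> t - \<theta> s"
  shows "b * ((t - a) powr (- \<alpha>) / \<alpha>) - 2 * c * ((t - a) powr (1 - \<alpha>) / (1 - \<alpha>))
    \<le> caputo_upto \<alpha> (t - \<delta>) v t + caputo_between \<alpha> (t - \<delta>) t \<theta> t"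
proof -
  define I where "I = (t - a) powr (1 - \<alpha>) / (1 - \<alpha>)"
  have t: "past_extension v t = v t" "past_extension \<theta> t = \<theta> t"
    using a by (auto simp: past_extension_def)
  \<comment> \<open>At \<open>s = t\<close> both sides are 0: the numerator vanishes, and
    \<open>0 powr x = 0\<close>.\<close>
  have quot: "- c * (t - s) / \<bar>t - s\<bar> powr (1 + \<alpha>) = - c * \<bar>t - s\<bar> powr (- \<alpha>)"
    if "s \<le> t" for s
    using that by (cases "s = t") (simp_all add: powr_add powr_minus field_simps)
  let ?tail = "\<lambda>s. indicator {..a} s * (1 / \<bar>t - s\<bar> powr (1 + \<alpha>))"
  let ?head = "\<lambda>a s. indicator {a..t} s * \<bar>t - s\<bar> powr (- \<alpha>)"
  have tail: "has_bochner_integral lborel ?tail ((t - a) powr (- \<alpha>) / \<alpha>)"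
    using has_bochner_integral_powr_tail[of \<alpha> a t] alpha a by auto
  have head: "has_bochner_integral lborel (?head a) I"
    unfolding I_def using has_bochner_integral_powr_head[of \<alpha> a t] alpha a by auto
  have "has_bochner_integral lborel (\<lambda>s. b * ?tail s - c * ?head a s)
      (b * ((t - a) powr (- \<alpha>) / \<alpha>) - c * I)"
    by (intro has_bochner_integral_diff has_bochner_integral_mult_right tail head)
  moreover have "integrable lborel (\<lambda>s. indicator {..t - \<delta>} s *\<^sub>R caputo_integrand \<alpha> v t s)"
    using set_integrable_caputo_integrand[of \<alpha> "t - \<delta>" t v] alpha a v
    by (simp add: set_integrable_def)
  moreover have "b * ?tail s - c * ?head a s
      \<le> indicator {..t - \<delta>} s *\<^sub>R caputo_integrand \<alpha> v t s" for s
  proof -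
    consider "s \<le> a" | "a < s" "s \<le> t - \<delta>" | "t - \<delta> < s" by linarith
    then show ?thesis
    proof cases
      case 1
      then have "b / \<bar>t - s\<bar> powr (1 + \<alpha>) \<le> caputo_integrand \<alpha> v t s"
        using far by (auto simp: caputo_integrand_def t intro!: divide_right_mono)
      moreover have "0 \<le> c * ?head a s" using c by simp
      ultimately show ?thesis using 1 a by simp
    next
      case 2
      then have "- c * (t - s) / \<bar>t - s\<bar> powr (1 + \<alpha>) \<le> caputo_integrand \<alpha> v t s"
        unfolding caputo_integrand_def t by (intro divide_right_mono near) auto
      then show ?thesis using 2 a by (subst (asm) quot) auto
    next
      case 3
      then show ?thesis using a c by simp
    qed
  qed
  ultimately have upto: "b * ((t - a) powr (- \<alpha>) / \<alpha>) - c * I \<le> caputo_upto \<alpha> (t - \<delta>) v t"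
    unfolding caputo_upto_def set_lebesgue_integral_def
    by (metis (no_types, lifting) has_bochner_integral_iff integral_mono)
  have "- (c * I) \<le> caputo_between \<alpha> (t - \<delta>) t \<theta> t"
  proof (cases "set_integrable lborel {t - \<delta>..t} (caputo_integrand \<alpha> \<theta> t)")
    case True
    have "has_bochner_integral lborel (\<lambda>s. - c * ?head a s) (- c * I)"
      by (intro has_bochner_integral_mult_right head)
    moreover have "- c * ?head a s \<le> indicator {t - \<delta>..t} s *\<^sub>R caputo_integrand \<alpha> \<theta> t s" for s
    proof (cases "t - \<delta> \<le> s \<and> s \<le> t")
      case True
      then have "- c * (t - s) / \<bar>t - s\<bar> powr (1 + \<alpha>) \<le> caputo_integrand \<alpha> \<theta> t s"
        unfolding caputo_integrand_def t using a test[of s]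
        by (intro divide_right_mono) (auto simp: past_extension_def)
      then show ?thesis using True a by (subst (asm) quot) auto
    next
      case False
      then show ?thesis using c by (auto simp: indicator_def)
    qed
    ultimately show ?thesis
      using True unfolding caputo_between_def set_lebesgue_integral_def set_integrable_def
      by (metis (no_types, lifting) has_bochner_integral_iff integral_mono mult_minus_left)
  next
    \<comment> \<open>Without integrability the integral takes the default value 0, which still lies
      above the nonpositive bound.\<close>
    case False
    then have "caputo_between \<alpha> (t - \<delta>) t \<theta> t = 0"
      unfolding caputo_between_def set_lebesgue_integral_def set_integrable_def
      by (simp add: not_integrable_integral_eq)
    moreover have "0 \<le> c * I" using c alpha by (auto simp: I_def)
    ultimately show ?thesis by simp
  qed
  with upto show ?thesis unfolding I_def by linarith
qed

section \<open>The torus\<close>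

lemma dist_to_torus: "dist (to_torus x) (to_torus y) = infdist (x - y) int_lattice"
  by (rule dist_torus.abs_eq)

lemma dist_to_torus_le: "dist (to_torus x) (to_torus y) \<le> dist x y"
  using infdist_le[OF int_lattice_0, of "x - y"] by (simp add: dist_to_torus dist_norm)

lemma continuous_on_to_torus: "continuous_on S to_torus"
  unfolding continuous_on_iff using dist_to_torus_le le_less_trans by blast

lemma to_torus_surj: "\<exists>y. x = to_torus y"
  by (metis Quotient3_abs_rep Quotient3_torus)

text \<open>The lattice is closed, so the infimum defining the distance is attained. Estimates near
  a point can then use a Euclidean displacement of exactly the torus length.\<close>

lemma torus_nearest_lift:
  obtains h where "x = to_torus (y + h)" "norm h = dist x (to_torus y)"
proof -
  obtain w where w: "x = to_torus w" using to_torus_surj by blast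
  obtain k where k: "k \<in> int_lattice" "infdist (w - y) int_lattice = dist (w - y) k"
    using infdist_attains_inf[OF closed_int_lattice int_lattice_nonempty] by blast
  show thesis
  proof
    show "x = to_torus (y + (w - y - k))"
      using k by (simp add: w to_torus_eq_iff)
    show "norm (w - y - k) = dist x (to_torus y)"
      using k by (simp add: w dist_to_torus dist_norm)
  qed
qed

lemma compact_torus: "compact (UNIV :: 'n::finite torus set)"
proof -
  have "x \<in> to_torus ` cbox 0 (1 :: real ^ 'n)" for x :: "'n torus"
  proof -
    obtain w where w: "x = to_torus w" using to_torus_surj by blast
    define y :: "real ^ 'n" where "y = (\<chi> i. frac (w $ i))"
    have "w - y \<in> int_lattice"
      by (auto simp: int_lattice_def y_def frac_def)
    moreover have "y \<in> cbox 0 1"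
      by (auto simp: mem_box_cart y_def less_imp_le[OF frac_lt_1])
    ultimately show ?thesis
      unfolding w by (metis imageI to_torus_eq_iff)
  qed
  then have "(UNIV :: 'n torus set) = to_torus ` cbox 0 1" by blast
  then show ?thesis
    by (metis compact_cbox compact_continuous_image continuous_on_to_torus)
qed

section \<open>Periodic test functions\<close>

text \<open>A smooth 1-periodic function tangent to the identity at 0; it replaces a coordinate,
  which does not descend to the torus.\<close>

definition periodic_id :: "real \<Rightarrow> real" where
  "periodic_id s = sin (2 * pi * s) / (2 * pi)"

lemma periodic_id_int_shift: "k \<in> \<int> \<Longrightarrow> periodic_id (s + k) = periodic_id s"
  by (auto simp: periodic_id_def ring_distribs sin_add elim!: Ints_cases)

lemma periodic_id_has_derivative:
  "(periodic_id has_real_derivative cos (2 * pi * s)) (at s)"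
  unfolding periodic_id_def by (auto intro!: derivative_eq_intros)

lemma periodic_id_approx: "\<bar>periodic_id s - s\<bar> \<le> pi * s\<^sup>2"
proof -
  have "\<bar>sin (2 * pi * s) - 2 * pi * s\<bar> \<le> (2 * pi * s)\<^sup>2 / 2"
    using Maclaurin_sin_bound[of "2 * pi * s" 2]
    by (simp add: numeral_2_eq_2 sin_coeff_def)
  moreover have "periodic_id s - s = (sin (2 * pi * s) - 2 * pi * s) / (2 * pi)"
    by (simp add: periodic_id_def field_simps)
  ultimately show ?thesis
    by (simp add: abs_divide divide_le_eq power2_eq_square algebra_simps)
qed

text \<open>In this range \<open>pi < 4\<close> bounds the quadratic error by half of
  \<open>\<bar>s\<bar>\<close>, so at least half of \<open>\<bar>s\<bar>\<close> survives.\<close>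

lemma periodic_id_square_lower:
  assumes "\<bar>s\<bar> \<le> 1 / 8"
  shows "s\<^sup>2 / 4 \<le> (periodic_id s)\<^sup>2"
proof -
  have "pi * s\<^sup>2 \<le> 4 * (\<bar>s\<bar> * (1 / 8))"
    using pi_less_4 assms unfolding power2_eq_square abs_mult_self_eq[symmetric, of s]
    by (intro mult_mono mult_left_mono) auto
  then have "\<bar>s\<bar> / 2 \<le> \<bar>periodic_id s\<bar>"
    using periodic_id_approx[of s] by linarith
  then have "(\<bar>s\<bar> / 2)\<^sup>2 \<le> \<bar>periodic_id s\<bar>\<^sup>2"
    by (intro power_mono) auto
  then show ?thesis
    by (simp add: power_divide)
qed

text \<open>A \<open>\<int>\<^sup>N\<close>-periodic substitute for the quadratic polynomial \<open>p \<bullet> h + C |h|\<^sup>2\<close>, \<open>h = y - y\<^sub>0\<close>.\<close>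

definition periodic_quadratic ::
  "real ^ 'n::finite \<Rightarrow> real ^ 'n \<Rightarrow> real \<Rightarrow> real ^ 'n \<Rightarrow> real" where
  "periodic_quadratic y0 p C y =
    (\<Sum>i\<in>UNIV. p $ i * periodic_id (y $ i - y0 $ i) + C * (periodic_id (y $ i - y0 $ i))\<^sup>2)"

text \<open>\<open>torus_rep\<close> picks an arbitrary representative; periodicity removes the
  dependence on that choice.\<close>

lemma periodic_quadratic_torus:
  "periodic_quadratic y0 p C (torus_rep (to_torus y)) = periodic_quadratic y0 p C y"
proof -
  have "to_torus (torus_rep (to_torus y)) = to_torus y"
    by (rule Quotient3_abs_rep[OF Quotient3_torus])
  then have "torus_rep (to_torus y) - y \<in> int_lattice"
    by (simp add: to_torus_eq_iff)
  then have k: "(torus_rep (to_torus y) - y) $ i \<in> \<int>" for i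
    by (auto simp: int_lattice_def)
  have "periodic_id (torus_rep (to_torus y) $ i - y0 $ i) = periodic_id (y $ i - y0 $ i)" for i
    using periodic_id_int_shift[OF k, of "y $ i - y0 $ i" i] by simp
  then show ?thesis
    by (simp add: periodic_quadratic_def)
qed

lemma periodic_quadratic_has_derivative:
  "(periodic_quadratic y0 p C has_derivative
    (\<lambda>h. h \<bullet> (\<chi> i. (p $ i + 2 * C * periodic_id (y $ i - y0 $ i)) * cos (2 * pi * (y $ i - y0 $ i)))))
    (at y)"
proof -
  have *: "((\<lambda>y. periodic_id (y $ i - y0 $ i)) has_derivative
      (\<lambda>h. h $ i * cos (2 * pi * (y $ i - y0 $ i)))) (at y)" for i
  proof -
    have "((\<lambda>y. y $ i - y0 $ i) has_derivative (\<lambda>h. h $ i)) (at y)"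
      by (auto intro!: derivative_eq_intros bounded_linear_imp_has_derivative bounded_linear_vec_nth)
    from has_derivative_compose[OF this periodic_id_has_derivative[unfolded has_field_derivative_def]]
    show ?thesis by (simp add: mult.commute)
  qed
  show ?thesis
    unfolding periodic_quadratic_def
    by (auto intro!: derivative_eq_intros * sum.cong
        simp: inner_vec_def algebra_simps)
qed

text \<open>Replacing \<open>h $ i\<close> in the linear part costs at most
  \<open>norm p * pi * (h $ i)\<^sup>2\<close>, while the squared periodic term keeps a quarter of
  \<open>(h $ i)\<^sup>2\<close>. Hence \<open>C\<close> is 4 times the sum of \<open>C0\<close> and
  \<open>pi * norm p\<close>.\<close>

lemma periodic_quadratic_lower:
  assumes "\<And>i. \<bar>h $ i\<bar> \<le> 1 / 8" and C: "C = 4 * (C0 + pi * norm p)" "0 \<le> C0"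
  shows "p \<bullet> h + C0 * (norm h)\<^sup>2 \<le> periodic_quadratic y0 p C (y0 + h)"
proof -
  have "(norm h)\<^sup>2 = (\<Sum>i\<in>UNIV. (h $ i)\<^sup>2)"
    unfolding power2_norm_eq_inner by (simp add: inner_vec_def power2_eq_square)
  then have "p \<bullet> h + C0 * (norm h)\<^sup>2 = (\<Sum>i\<in>UNIV. p $ i * h $ i + C0 * (h $ i)\<^sup>2)"
    by (simp add: inner_vec_def sum.distrib sum_distrib_left)
  also have "\<dots> \<le> periodic_quadratic y0 p C (y0 + h)"
    unfolding periodic_quadratic_def
  proof (intro sum_mono)
    fix i
    let ?s = "periodic_id (h $ i)"
    have "p $ i * (h $ i - ?s) \<le> \<bar>p $ i\<bar> * \<bar>h $ i - ?s\<bar>"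
      by (metis abs_ge_self abs_mult)
    also have "\<dots> \<le> norm p * (pi * (h $ i)\<^sup>2)"
      using periodic_id_approx[of "h $ i"] component_le_norm_cart[of p i]
      by (intro mult_mono) (auto simp: abs_minus_commute)
    finally have 1: "p $ i * h $ i - p $ i * ?s \<le> norm p * pi * (h $ i)\<^sup>2"
      by (simp add: algebra_simps)
    have "C * ((h $ i)\<^sup>2 / 4) \<le> C * ?s\<^sup>2"
      using C periodic_id_square_lower[OF assms(1), of i] by (intro mult_left_mono) auto
    moreover have "C * ((h $ i)\<^sup>2 / 4) = C0 * (h $ i)\<^sup>2 + norm p * pi * (h $ i)\<^sup>2"
      unfolding C by (simp add: algebra_simps)
    ultimately have "C0 * (h $ i)\<^sup>2 + norm p * pi * (h $ i)\<^sup>2 \<le> C * ?s\<^sup>2"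
      by linarith
    with 1 show "p $ i * h $ i + C0 * (h $ i)\<^sup>2
        \<le> p $ i * periodic_id ((y0 + h) $ i - y0 $ i) + C * (periodic_id ((y0 + h) $ i - y0 $ i))\<^sup>2"
      by simp
  qed
  finally show ?thesis .
qed

lemma periodic_quadratic_center: "periodic_quadratic y0 p C y0 = 0"
  by (simp add: periodic_quadratic_def periodic_id_def)

section \<open>Viscosity tests by a function of time plus a periodic quadratic\<close>

lemma C1_torus_time_separated:
  assumes \<theta>: "\<And>t. t > 0 \<Longrightarrow> (\<theta> has_real_derivative \<theta>' t) (at t)" "continuous_on {0<..} \<theta>'"
  shows "C1_torus_time (\<lambda>x t. \<theta> t + periodic_quadratic y0 p C (torus_rep x))"
proof -
  define G where "G y = (\<chi> i. (p $ i + 2 * C * periodic_id (y $ i - y0 $ i)) *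
    cos (2 * pi * (y $ i - y0 $ i)))" for y
  have G: "continuous_on UNIV G"
    unfolding G_def periodic_id_def by (intro continuous_intros) auto
  \<comment> \<open>Writing the derivative as the inner product with the gradient reduces its
    continuity to that of \<open>G\<close> and \<open>\<theta>'\<close>.\<close>
  define D where "D z = blinfun_inner_right (G (fst z), \<theta>' (snd z))" for z
  have "continuous_on (UNIV \<times> {0<..}) D"
    unfolding D_def
    by (intro bounded_linear.continuous_on[OF bounded_linear_blinfun_inner_right] continuous_on_Pair
        continuous_on_compose2[OF G] continuous_on_compose2[OF \<theta>(2)] continuous_intros) auto
  moreover have "((\<lambda>(y, t). \<theta> t + periodic_quadratic y0 p C (torus_rep (to_torus y)))
      has_derivative blinfun_apply (D z)) (at z)" if "z \<in> UNIV \<times> {0<..}" for z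
  proof -
    have "((\<lambda>z. \<theta> (snd z)) has_derivative (\<lambda>h. \<theta>' (snd z) * snd h)) (at z)"
      by (rule has_derivative_compose[OF has_derivative_snd[OF has_derivative_ident]])
        (use \<theta>(1)[of "snd z"] that in \<open>auto simp: has_field_derivative_def\<close>)
    moreover have "((\<lambda>z. periodic_quadratic y0 p C (fst z)) has_derivative (\<lambda>h. fst h \<bullet> G (fst z))) (at z)"
      by (rule has_derivative_compose[OF has_derivative_fst[OF has_derivative_ident]])
        (use periodic_quadratic_has_derivative in \<open>auto simp: G_def\<close>)
    ultimately have "((\<lambda>z. \<theta> (snd z) + periodic_quadratic y0 p C (fst z)) has_derivative
        (\<lambda>h. \<theta>' (snd z) * snd h + fst h \<bullet> G (fst z))) (at z)"
      by (rule has_derivative_add)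
    moreover have "blinfun_apply (D z) = (\<lambda>h. \<theta>' (snd z) * snd h + fst h \<bullet> G (fst z))"
      by (auto simp: D_def inner_prod_def inner_commute)
    ultimately show ?thesis
      by (simp add: case_prod_beta' periodic_quadratic_torus)
  qed
  ultimately show ?thesis
    unfolding C1_torus_time_def by blast
qed

lemma torus_grad_separated:
  "torus_grad (\<lambda>x. \<theta> t + periodic_quadratic y0 p C (torus_rep x)) (to_torus y0) = p"
proof (rule torus_grad_eqI)
  have "((\<lambda>y. \<theta> t + periodic_quadratic y0 p C y) has_derivative (\<lambda>h. 0 + h \<bullet> p)) (at y0)"
    using periodic_quadratic_has_derivative[of y0 p C y0]
    by (intro has_derivative_add has_derivative_const) (simp add: periodic_id_def)
  then show "GDERIV (\<lambda>y. \<theta> t + periodic_quadratic y0 p C (torus_rep (to_torus y))) y0 :> p"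
    by (simp add: gderiv_def periodic_quadratic_torus)
qed

lemma caputo_between_add_const:
  assumes "0 \<le> a" "0 \<le> t"
  shows "caputo_between \<alpha> a b (\<lambda>s. \<theta> s + c) t = caputo_between \<alpha> a b \<theta> t"
  using assms unfolding caputo_between_def
  by (intro set_lebesgue_integral_cong) (auto simp: caputo_integrand_def past_extension_def)

text \<open>A quadratic bound in the Euclidean displacement suffices for a test: for displacements
  below 1/8 the periodic quadratic dominates it, with the same value and gradient at the
  centre.\<close>

lemma subsolution_quadratic_test:
  assumes sub: "viscosity_subsolution \<alpha> H u"
    and \<theta>: "\<And>t. t > 0 \<Longrightarrow> (\<theta> has_real_derivative \<theta>' t) (at t)" "continuous_on {0<..} \<theta>'"
    and x0: "x0 = to_torus y0" and C0: "0 \<le> C0"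
    and \<delta>: "0 < \<delta>" "\<delta> < t0" "\<delta> \<le> 1 / 8"
    and touch: "\<And>h t. norm h < \<delta> \<Longrightarrow> \<bar>t - t0\<bar> \<le> \<delta> \<Longrightarrow>
      u (to_torus (y0 + h)) t - \<theta> t \<le> u x0 t0 - \<theta> t0 + p \<bullet> h + C0 * (norm h)\<^sup>2"
  shows "caputo_upto \<alpha> (t0 - \<delta>) (u x0) t0 + caputo_between \<alpha> (t0 - \<delta>) t0 \<theta> t0 + H x0 p \<le> 0"
proof -
  define C where "C = 4 * (C0 + pi * norm p)"
  define \<phi> where "\<phi> x t = \<theta> t + periodic_quadratic y0 p C (torus_rep x)" for x t
  have "u x t - \<phi> x t \<le> u x0 t0 - \<phi> x0 t0" if x: "x \<in> ball x0 \<delta>" and t: "t \<in> {t0 - \<delta>..t0 + \<delta>}" for x t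
  proof -
    obtain h where h: "x = to_torus (y0 + h)" "norm h = dist x x0"
      using torus_nearest_lift unfolding x0 by blast
    have h\<delta>: "norm h < \<delta>" using h x by (simp add: dist_commute)
    then have "\<bar>h $ i\<bar> \<le> 1 / 8" for i
      using component_le_norm_cart[of h i] \<delta> by linarith
    then have "p \<bullet> h + C0 * (norm h)\<^sup>2 \<le> periodic_quadratic y0 p C (y0 + h)"
      by (intro periodic_quadratic_lower C_def C0)
    with touch[OF h\<delta>, of t] t show ?thesis
      by (simp add: \<phi>_def x0 h(1) periodic_quadratic_torus periodic_quadratic_center abs_le_iff)
  qed
  moreover have "C1_torus_time \<phi>"
    unfolding \<phi>_def using \<theta> by (rule C1_torus_time_separated)
  ultimately have "viscosity_lhs \<alpha> H u \<phi> \<delta> x0 t0 \<le> 0"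
    using sub \<delta> unfolding viscosity_subsolution_def by force
  moreover have "torus_grad (\<lambda>x. \<phi> x t0) x0 = p"
    unfolding \<phi>_def x0 by (rule torus_grad_separated)
  moreover have "caputo_between \<alpha> (t0 - \<delta>) t0 (\<phi> x0) t0 = caputo_between \<alpha> (t0 - \<delta>) t0 \<theta> t0"
    unfolding \<phi>_def using \<delta> by (intro caputo_between_add_const) auto
  ultimately show ?thesis
    unfolding viscosity_lhs_def by simp
qed

section \<open>Barriers built from the distance\<close>

text \<open>Here \<open>e\<close> stands for a torus distance, at most the Euclidean distance to a
  lift \<open>z'\<close>. The squared norm expands exactly, and the norm itself is concave as a
  function of its square. The vertex \<open>d = 0\<close> is allowed only for
  \<open>\<beta> = 0\<close>, where \<open>\<beta> / d\<close> is 0.\<close>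

lemma distance_barrier_quadratic_bound:
  fixes y0 z' h :: "real ^ 'n::finite"
  assumes \<beta>: "0 \<le> \<beta>" and \<gamma>: "0 \<le> \<gamma>"
    and d: "d = norm (y0 - z')" "\<beta> = 0 \<or> d \<noteq> 0"
    and e: "0 \<le> e" "e \<le> norm (y0 + h - z')"
  shows "\<beta> * e + \<gamma> * e\<^sup>2 \<le> \<beta> * d + \<gamma> * d\<^sup>2
    + ((\<beta> / d + 2 * \<gamma>) *\<^sub>R (y0 - z')) \<bullet> h + (\<beta> / (2 * d) + \<gamma>) * (norm h)\<^sup>2"
proof -
  define k where "k = (y0 - z') \<bullet> h"
  define m where "m = (norm h)\<^sup>2"
  define E where "E = norm (y0 + h - z')"
  have "E\<^sup>2 = (norm (y0 - z' + h))\<^sup>2"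
    by (simp add: E_def algebra_simps)
  also have "\<dots> = d\<^sup>2 + 2 * k + m"
    unfolding k_def m_def d(1) power2_norm_eq_inner
    by (simp add: inner_add_left inner_add_right inner_commute)
  finally have E: "E\<^sup>2 = d\<^sup>2 + 2 * k + m" .
  have eE: "e\<^sup>2 \<le> E\<^sup>2" "e \<le> E"
    using e by (auto simp: E_def intro: power_mono)
  then have "\<gamma> * e\<^sup>2 \<le> \<gamma> * (d\<^sup>2 + 2 * k + m)"
    using \<gamma> by (simp add: E mult_left_mono)
  moreover have "\<beta> * e \<le> \<beta> * d + \<beta> / d * k + \<beta> / (2 * d) * m"
  proof (cases "\<beta> = 0")
    case False
    then have d0: "d > 0" using d by (auto simp: order_less_le)
    \<comment> \<open>Dividing \<open>2 * d * E \<le> d\<^sup>2 + E\<^sup>2\<close> by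
      \<open>2 * d\<close> linearizes the square root, with a quadratic remainder.\<close>
    have "0 \<le> (E - d)\<^sup>2" by simp
    then have "2 * d * E \<le> 2 * d\<^sup>2 + 2 * k + m"
      using E by (simp add: power2_eq_square algebra_simps)
    then have "E \<le> d + k / d + m / (2 * d)"
      using d0 by (simp add: field_simps power2_eq_square)
    then have "\<beta> * e \<le> \<beta> * (d + k / d + m / (2 * d))"
      using \<beta> eE by (intro mult_left_mono) auto
    then show ?thesis by (simp add: algebra_simps)
  qed simp
  ultimately have "\<beta> * e + \<gamma> * e\<^sup>2 \<le> \<beta> * d + \<gamma> * d\<^sup>2 + (\<beta> / d + 2 * \<gamma>) * k + (\<beta> / (2 * d) + \<gamma>) * m"
    by (simp add: algebra_simps)
  then show ?thesis by (simp add: k_def m_def)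
qed

lemma continuous_on_time_slice:
  assumes "continuous_on (UNIV \<times> {0..}) (\<lambda>(x, t). u x t)"
  shows "continuous_on {0::real..} (u x)"
proof -
  have "continuous_on {0::real..} (\<lambda>t. (x, t))"
    by (intro continuous_intros)
  from continuous_on_compose2[OF assms this] show ?thesis
    by auto
qed

text \<open>Common core of the subsolution arguments: the barrier is touched from above at
  \<open>x0\<close> by a quadratic with gradient \<open>p\<close>, maximality over the time window
  transfers the slope bound of \<open>\<theta>\<close> to \<open>u\<close>, and \<open>b\<close>
  accounts for the remote past.\<close>

lemma subsolution_barrier_estimate:
  fixes u :: "'n::finite torus \<Rightarrow> real \<Rightarrow> real"
  assumes sub: "viscosity_subsolution \<alpha> H u" and alpha: "0 < \<alpha>" "\<alpha> < 1"
    and \<theta>: "\<And>t. t > 0 \<Longrightarrow> (\<theta> has_real_derivative \<theta>' t) (at t)" "continuous_on {0<..} \<theta>'"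
    and w: "0 \<le> w1" "w1 \<le> a" "a < t0" "t0 < w2"
    and \<beta>: "0 \<le> \<beta>" and \<gamma>: "0 \<le> \<gamma>" and \<beta>x: "\<beta> = 0 \<or> x0 \<noteq> z" and c: "0 \<le> c"
    and max: "\<And>x t. w1 \<le> t \<Longrightarrow> t \<le> w2 \<Longrightarrow>
      u x t - (\<beta> * dist x z + \<gamma> * (dist x z)\<^sup>2) - \<theta> t
      \<le> u x0 t0 - (\<beta> * dist x0 z + \<gamma> * (dist x0 z)\<^sup>2) - \<theta> t0"
    and near: "\<And>s. a \<le> s \<Longrightarrow> s \<le> t0 \<Longrightarrow> - c * (t0 - s) \<le> \<theta> t0 - \<theta> s"
    and far: "\<And>s. s \<le> a \<Longrightarrow> b \<le> u x0 t0 - past_extension (u x0) s"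
  obtains p where "norm p = \<beta> + 2 * \<gamma> * dist x0 z"
    and "b * ((t0 - a) powr (- \<alpha>) / \<alpha>) - 2 * c * ((t0 - a) powr (1 - \<alpha>) / (1 - \<alpha>)) + H x0 p \<le> 0"
proof -
  obtain z' where z': "z = to_torus z'" using to_torus_surj by blast
  \<comment> \<open>With the lift nearest to \<open>z'\<close>, torus and Euclidean distances agree
    at \<open>x0\<close>; at neighbouring points the torus distance can only be smaller, so the
    Euclidean barrier still lies above.\<close>
  obtain v where v: "x0 = to_torus (z' + v)" "norm v = dist x0 z"
    using torus_nearest_lift unfolding z' by blast
  define y0 where "y0 = z' + v"
  define d where "d = dist x0 z"
  have d: "d = norm (y0 - z')" "\<beta> = 0 \<or> d \<noteq> 0"
    using v \<beta>x by (auto simp: y0_def d_def)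
  define p where "p = (\<beta> / d + 2 * \<gamma>) *\<^sub>R (y0 - z')"
  define C0 where "C0 = \<beta> / (2 * d) + \<gamma>"
  \<comment> \<open>The bound 1/8 admits the periodic quadratic, the second term puts
    \<open>t0 - \<delta>\<close> after \<open>a\<close>, and the third keeps the test inside the
    window. Since \<open>0 \<le> a\<close>, also \<open>\<delta> < t0\<close>.\<close>
  define \<delta> where "\<delta> = min (1 / 8) (min ((t0 - a) / 2) (w2 - t0))"
  have \<delta>: "0 < \<delta>" "\<delta> < t0" "\<delta> \<le> 1 / 8" "a < t0 - \<delta>" "t0 + \<delta> \<le> w2"
    using w by (auto simp: \<delta>_def min_def field_simps)
  have "0 \<le> d" by (simp add: d_def)
  have "norm p = \<beta> + 2 * \<gamma> * dist x0 z"
  proof -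
    have "norm p = (\<beta> / d + 2 * \<gamma>) * d"
      using \<open>0 \<le> d\<close> \<beta> \<gamma> unfolding p_def by (simp add: d(1)[symmetric])
    also have "\<dots> = \<beta> + 2 * \<gamma> * d"
      using d(2) by (auto simp: algebra_simps)
    finally show ?thesis by (simp add: d_def)
  qed
  moreover have "caputo_upto \<alpha> (t0 - \<delta>) (u x0) t0 + caputo_between \<alpha> (t0 - \<delta>) t0 \<theta> t0 + H x0 p \<le> 0"
  proof (rule subsolution_quadratic_test[OF sub \<theta> _ _ \<delta>(1-3)])
    show "x0 = to_torus y0" by (simp add: v y0_def)
    show "0 \<le> C0" using \<open>0 \<le> d\<close> \<beta> \<gamma> by (simp add: C0_def)
    fix h :: "real ^ 'n" and t assume "norm h < \<delta>" "\<bar>t - t0\<bar> \<le> \<delta>"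
    then have t: "w1 \<le> t" "t \<le> w2" using \<delta> w by auto
    let ?x = "to_torus (y0 + h)"
    have "dist ?x z \<le> norm (y0 + h - z')"
      using dist_to_torus_le[of "y0 + h" z'] by (simp add: z' dist_norm)
    then have "\<beta> * dist ?x z + \<gamma> * (dist ?x z)\<^sup>2 \<le> \<beta> * d + \<gamma> * d\<^sup>2 + p \<bullet> h + C0 * (norm h)\<^sup>2"
      unfolding p_def C0_def by (intro distance_barrier_quadratic_bound \<beta> \<gamma> d) auto
    with max[OF t, of ?x] show "u ?x t - \<theta> t \<le> u x0 t0 - \<theta> t0 + p \<bullet> h + C0 * (norm h)\<^sup>2"
      unfolding d_def by linarith
  qed
  moreover have "b * ((t0 - a) powr (- \<alpha>) / \<alpha>) - 2 * c * ((t0 - a) powr (1 - \<alpha>) / (1 - \<alpha>))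
      \<le> caputo_upto \<alpha> (t0 - \<delta>) (u x0) t0 + caputo_between \<alpha> (t0 - \<delta>) t0 \<theta> t0"
  proof (rule caputo_lower_bound[OF alpha _ \<delta>(1,2) c _ far])
    show "a \<le> t0 - \<delta>" using \<delta> by simp
    show "continuous_on {0..} (u x0)"
      using sub by (intro continuous_on_time_slice) (simp add: viscosity_subsolution_def)
    show "- c * (t0 - s) \<le> u x0 t0 - past_extension (u x0) s" if "a < s" "s \<le> t0 - \<delta>" for s
    proof -
      have s: "w1 \<le> s" "s \<le> w2" "a \<le> s" "s \<le> t0" "\<not> s < 0" using that w \<delta> by auto
      from max[OF s(1,2), of x0] near[OF s(3,4)] s show ?thesis
        by (simp add: past_extension_def)
    qed
    show "- c * (t0 - s) \<le> \<theta> t0 - \<theta> s" if "t0 - \<delta> \<le> s" "s \<le> t0" for s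
      using that \<delta> by (intro near) auto
  qed
  ultimately show thesis
    by (intro that[of p]) linarith+
qed

section \<open>Penalization in time\<close>

lemma has_real_derivative_max_0_square:
  "((\<lambda>s::real. (max 0 s)\<^sup>2) has_real_derivative 2 * max 0 s) (at s)"
proof -
  consider "s < 0" | "s > 0" | "s = 0" by linarith
  then show ?thesis
  proof cases
    case 1
    have "((\<lambda>s::real. (max 0 s)\<^sup>2) has_real_derivative 0) (at s)"
    proof (rule has_field_derivative_transform_within_open[of "\<lambda>_. 0" 0 s "{..<0}"])
      show "0 = (max 0 x)\<^sup>2" if "x \<in> {..<0}" for x :: real
        using that by (simp add: max_def)
    qed (use 1 in simp_all)
    with 1 show ?thesis by simp
  next
    case 2
    have "((\<lambda>s::real. s\<^sup>2) has_real_derivative 2 * s) (at s)"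
      by (auto intro!: derivative_eq_intros)
    then have "((\<lambda>s::real. (max 0 s)\<^sup>2) has_real_derivative 2 * s) (at s)"
    proof (rule has_field_derivative_transform_within_open[of _ _ s "{0<..}"])
      show "x\<^sup>2 = (max 0 x)\<^sup>2" if "x \<in> {0<..}" for x :: real
        using that by (simp add: max_def)
    qed (use 2 in simp_all)
    with 2 show ?thesis by simp
  next
    case 3
    have "((\<lambda>h::real. (max 0 h)\<^sup>2 / h) \<longlongrightarrow> 0) (at 0)"
    proof (rule Lim_null_comparison)
      show "\<forall>\<^sub>F h in at 0. norm ((max 0 h)\<^sup>2 / h) \<le> \<bar>h\<bar>"
        by (intro always_eventually) (auto simp: max_def power2_eq_square)
      show "((\<lambda>h::real. \<bar>h\<bar>) \<longlongrightarrow> 0) (at 0)"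
        by (intro tendsto_rabs_zero tendsto_ident_at)
    qed
    with 3 show ?thesis by (simp add: DERIV_def)
  qed
qed

text \<open>Viscosity tests need a maximum that is interior in time; a penalty switched on after the
  time \<open>T\<close> keeps it away from the final time without affecting \<open>[0, T]\<close>.\<close>

lemma penalized_max_exists:
  fixes w :: "'n::finite torus \<Rightarrow> real \<Rightarrow> real"
  assumes T: "0 \<le> T" and w: "continuous_on (UNIV \<times> {0..}) (\<lambda>(x, t). w x t)"
  obtains \<theta> \<theta>' t0 x0 where "\<And>t. (\<theta> has_real_derivative \<theta>' t) (at t)" "continuous_on UNIV \<theta>'"
    "mono \<theta>" "\<And>t. 0 \<le> \<theta> t" "\<And>t. t \<le> T \<Longrightarrow> \<theta> t = 0" "0 \<le> t0" "t0 < T + 1"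
    "\<And>x t. 0 \<le> t \<Longrightarrow> t \<le> T + 1 \<Longrightarrow> w x t - \<theta> t \<le> w x0 t0 - \<theta> t0"
proof -
  let ?K = "(UNIV :: 'n torus set) \<times> {0..T + 1}"
  have K: "compact ?K" "?K \<noteq> {}"
    using T by (auto intro: compact_Times compact_torus)
  have wK: "continuous_on ?K (\<lambda>(x, t). w x t)"
    by (rule continuous_on_subset[OF w]) auto
  obtain P where P: "\<forall>y \<in> (\<lambda>(x, t). w x t) ` ?K. norm y \<le> P"
    using compact_imp_bounded[OF compact_continuous_image[OF wK K(1)]] bounded_iff by metis
  have P: "\<bar>w x t\<bar> \<le> P" if "0 \<le> t" "t \<le> T + 1" for x t
    using P that by force
  have P0: "0 \<le> P" using P[of 0] T by fastforce
  \<comment> \<open>The square makes the penalty continuously differentiable at \<open>T\<close>.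
    Its factor exceeds the oscillation bound \<open>2 * P\<close>, so the penalized value at time
    \<open>T + 1\<close> is below every value at time 0.\<close>
  define \<theta> where "\<theta> t = (2 * P + 1) * (max 0 (t - T))\<^sup>2" for t
  define \<theta>' where "\<theta>' t = (2 * P + 1) * (2 * max 0 (t - T))" for t
  have d: "(\<theta> has_real_derivative \<theta>' t) (at t)" for t
  proof -
    have "((\<lambda>t. t - T) has_real_derivative 1) (at t)"
      by (auto intro!: derivative_eq_intros)
    from DERIV_chain2[OF has_real_derivative_max_0_square this]
    show ?thesis
      unfolding \<theta>_def \<theta>'_def by (intro DERIV_cmult) simp
  qed
  have c\<theta>: "continuous_on UNIV \<theta>"
    using d by (meson DERIV_isCont continuous_at_imp_continuous_on)
  have "continuous_on ?K (\<lambda>z. \<theta> (snd z))"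
    by (rule continuous_on_compose2[OF c\<theta> continuous_on_snd[OF continuous_on_id]]) auto
  from continuous_attains_sup[OF K continuous_on_diff[OF wK this]]
  obtain x0 t0 where x0: "t0 \<in> {0..T + 1}"
      "\<And>x t. t \<in> {0..T + 1} \<Longrightarrow> w x t - \<theta> t \<le> w x0 t0 - \<theta> t0"
    by force
  have \<theta>0: "\<theta> t = 0" if "t \<le> T" for t using that by (simp add: \<theta>_def)
  have "t0 \<noteq> T + 1"
  proof
    assume "t0 = T + 1"
    then have "\<theta> t0 = 2 * P + 1" by (simp add: \<theta>_def)
    then show False
      using x0(2)[of 0 x0] \<theta>0[of 0] P[of 0 x0] P[of t0 x0] T x0(1) by auto
  qed
  show thesis
  proof (rule that[of \<theta> \<theta>' t0 x0])
    show "continuous_on UNIV \<theta>'" unfolding \<theta>'_def by (intro continuous_intros)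
    show "mono \<theta>" unfolding \<theta>_def using P0
      by (intro monoI mult_left_mono power_mono) auto
    show "0 \<le> \<theta> t" for t using P0 by (simp add: \<theta>_def)
    show "w x t - \<theta> t \<le> w x0 t0 - \<theta> t0" if "0 \<le> t" "t \<le> T + 1" for x t
      using x0(2)[of t x] that by simp
  qed (use d x0(1) \<theta>0 \<open>t0 \<noteq> T + 1\<close> in auto)
qed

section \<open>Comparison estimates\<close>

text \<open>At a penalized minimum below \<open>m\<close> the gradient is 0 and
  \<open>H x0 0 \<le> 0\<close>, while the Caputo term is strictly negative because the values
  before time 0 are at least \<open>m\<close>.\<close>

lemma supersolution_ge_initial_min:
  fixes u :: "'n::finite torus \<Rightarrow> real \<Rightarrow> real"
  assumes super: "viscosity_supersolution \<alpha> H u" and alpha: "0 < \<alpha>" "\<alpha> < 1"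
    and H: "\<And>x. H x 0 \<le> 0" and initial: "\<And>x. m \<le> u x 0" and "0 \<le> t"
  shows "m \<le> u x t"
proof (rule ccontr)
  assume "\<not> m \<le> u x t"
  have cont: "continuous_on (UNIV \<times> {0..}) (\<lambda>(x, t). u x t)"
    using super by (simp add: viscosity_supersolution_def)
  have wcont: "continuous_on (UNIV \<times> {0..}) (\<lambda>(x, t). - u x t)"
    using continuous_on_minus[OF cont] by (simp add: case_prod_beta')
  obtain \<theta> \<theta>' t0 x0 where \<theta>: "\<And>t. (\<theta> has_real_derivative \<theta>' t) (at t)" "continuous_on UNIV \<theta>'"
    "mono \<theta>" "\<And>t. 0 \<le> \<theta> t" "\<And>s. s \<le> t \<Longrightarrow> \<theta> s = 0" and t0: "0 \<le> t0" "t0 < t + 1"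
    and max: "\<And>x s. 0 \<le> s \<Longrightarrow> s \<le> t + 1 \<Longrightarrow> - u x s - \<theta> s \<le> - u x0 t0 - \<theta> t0"
    by (rule penalized_max_exists[OF \<open>0 \<le> t\<close> wcont]) (rule that)
  have less: "u x0 t0 < m"
    using max[of t x] \<theta>(4)[of t0] \<theta>(5)[of t] \<open>0 \<le> t\<close> \<open>\<not> m \<le> u x t\<close> by simp
  then have "0 < t0"
    using initial[of x0] t0 by (cases "t0 = 0") auto
  obtain y0 where y0: "x0 = to_torus y0" using to_torus_surj by blast
  \<comment> \<open>With zero coefficients the spatial part vanishes; this form lets the regularity
    and gradient lemmas for separated functions apply.\<close>
  define \<phi> where "\<phi> x t = - \<theta> t + periodic_quadratic y0 0 0 (torus_rep x)" for x :: "'n torus" and t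
  have \<phi>: "\<phi> x t = - \<theta> t" for x t
    by (simp add: \<phi>_def periodic_quadratic_def)
  define \<delta> where "\<delta> = min (t0 / 2) (t + 1 - t0)"
  have \<delta>: "0 < \<delta>" "\<delta> < t0" "t0 + \<delta> \<le> t + 1"
    using t0 \<open>0 < t0\<close> by (auto simp: \<delta>_def min_def)
  have "C1_torus_time \<phi>"
    unfolding \<phi>_def
  proof (rule C1_torus_time_separated)
    show "((\<lambda>t. - \<theta> t) has_real_derivative - \<theta>' t) (at t)" for t
      by (intro DERIV_minus \<theta>)
    show "continuous_on {0<..} (\<lambda>t. - \<theta>' t)"
      by (intro continuous_on_minus continuous_on_subset[OF \<theta>(2)]) auto
  qed
  moreover have "u x0 t0 - \<phi> x0 t0 \<le> u x s - \<phi> x s" if "s \<in> {t0 - \<delta>..t0 + \<delta>}" for x s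
    using max[of s x] that \<delta> by (simp add: \<phi>)
  ultimately have "0 \<le> viscosity_lhs \<alpha> H u \<phi> \<delta> x0 t0"
    using super \<delta> \<open>0 < t0\<close> unfolding viscosity_supersolution_def by blast
  moreover have "torus_grad (\<lambda>x. \<phi> x t0) x0 = 0"
    unfolding \<phi>_def y0 by (rule torus_grad_separated)
  moreover have "\<phi> x0 = (\<lambda>t. - \<theta> t)"
    by (auto simp: \<phi>)
  ultimately have "0 \<le> caputo_upto \<alpha> (t0 - \<delta>) (u x0) t0 - caputo_between \<alpha> (t0 - \<delta>) t0 \<theta> t0"
    using H[of x0] by (simp add: viscosity_lhs_def caputo_between_uminus)
  \<comment> \<open>The bound is applied to \<open>- u\<close> with the cut at time 0: earlier times
    contribute the jump \<open>m - u x0 t0\<close>, later ones nothing negative.\<close>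
  moreover have "(m - u x0 t0) * ((t0 - 0) powr (- \<alpha>) / \<alpha>) - 2 * 0 * ((t0 - 0) powr (1 - \<alpha>) / (1 - \<alpha>))
      \<le> caputo_upto \<alpha> (t0 - \<delta>) (\<lambda>s. - u x0 s) t0 + caputo_between \<alpha> (t0 - \<delta>) t0 \<theta> t0"
  proof (rule caputo_lower_bound[OF alpha _ \<delta>(1,2)])
    show "continuous_on {0..} (\<lambda>s. - u x0 s)"
      by (intro continuous_on_minus continuous_on_time_slice cont)
    show "m - u x0 t0 \<le> - u x0 t0 - past_extension (\<lambda>s. - u x0 s) s" if "s \<le> 0" for s
      using that initial[of x0] by (auto simp: past_extension_def)
    show "- 0 * (t0 - s) \<le> - u x0 t0 - past_extension (\<lambda>s. - u x0 s) s" if "0 < s" "s \<le> t0 - \<delta>" for s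
      using that max[of s x0] \<delta> monoD[OF \<theta>(3), of s t0] t0 by (auto simp: past_extension_def)
    show "- 0 * (t0 - s) \<le> \<theta> t0 - \<theta> s" if "s \<le> t0" for s
      using monoD[OF \<theta>(3) that] by simp
  qed (use \<delta> in auto)
  moreover have "0 < (m - u x0 t0) * (t0 powr (- \<alpha>) / \<alpha>)"
    using less \<open>0 < t0\<close> alpha by simp
  ultimately show False
    by (simp add: caputo_upto_uminus)
qed

text \<open>A quadratic penalty localizes the maximum near \<open>z\<close>, where \<open>f\<close>
  is small and initial values are close to \<open>u z 0\<close>. The jump over the initial value
  bounds the Caputo term below independently of the penalty, and \<open>- f x \<le> H x p\<close>
  handles the uncontrolled gradient.\<close>

lemma subsolution_le_initial_at_zero:
  fixes u :: "'n::finite torus \<Rightarrow> real \<Rightarrow> real"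
  assumes sub: "viscosity_subsolution \<alpha> H u" and alpha: "0 < \<alpha>" "\<alpha> < 1"
    and H: "\<And>x p. - f x \<le> H x p" and f: "continuous_on UNIV f" "f z = 0" and "0 \<le> t"
  shows "u z t \<le> u z 0"
proof (rule ccontr)
  assume "\<not> u z t \<le> u z 0"
  \<comment> \<open>Half of the excess absorbs the variation of the initial values near
    \<open>z\<close>; the other half remains as the jump over the past.\<close>
  define \<sigma> where "\<sigma> = (u z t - u z 0) / 2"
  have \<sigma>: "0 < \<sigma>" "u z t = u z 0 + 2 * \<sigma>"
    using \<open>\<not> u z t \<le> u z 0\<close> by (auto simp: \<sigma>_def field_simps)
  \<comment> \<open>The contribution of a jump \<open>\<sigma>\<close> over the times before 0
    decreases with the present time, so this bounds it below up to time
    \<open>t + 1\<close>.\<close>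
  define \<kappa> where "\<kappa> = \<sigma> * ((t + 1) powr (- \<alpha>) / \<alpha>)"
  have "0 < \<kappa>" using \<sigma> alpha \<open>0 \<le> t\<close> by (simp add: \<kappa>_def)
  have cont: "continuous_on (UNIV \<times> {0..}) (\<lambda>(x, t). u x t)"
    using sub by (simp add: viscosity_subsolution_def)
  have "continuous_on UNIV (\<lambda>x. (x, 0 :: real))"
    by (intro continuous_intros)
  from continuous_on_compose2[OF cont this]
  have "continuous_on UNIV (\<lambda>x. u x 0)"
    by auto
  then obtain \<rho>1 where \<rho>1: "0 < \<rho>1" "\<And>x. dist x z < \<rho>1 \<Longrightarrow> dist (u x 0) (u z 0) < \<sigma>"
    using \<sigma> unfolding continuous_on_iff by blast
  obtain \<rho>2 where \<rho>2: "0 < \<rho>2" "\<And>x. dist x z < \<rho>2 \<Longrightarrow> dist (f x) (f z) < \<kappa>"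
    using f(1) \<open>0 < \<kappa>\<close> unfolding continuous_on_iff by blast
  define \<rho> where "\<rho> = min \<rho>1 \<rho>2"
  have \<rho>: "0 < \<rho>" using \<rho>1 \<rho>2 by (simp add: \<rho>_def)
  have "compact ((\<lambda>(x, t). u x t) ` (UNIV \<times> {0..t + 1}))"
    by (intro compact_continuous_image compact_Times compact_torus continuous_on_subset[OF cont]) auto
  then obtain P where "\<forall>y \<in> (\<lambda>(x, t). u x t) ` (UNIV \<times> {0..t + 1}). norm y \<le> P"
    using compact_imp_bounded bounded_iff by metis
  then have P: "\<bar>u x s\<bar> \<le> P" if "0 \<le> s" "s \<le> t + 1" for x s
    using that by force
  \<comment> \<open>\<open>K * \<rho>\<^sup>2\<close> exceeds the oscillation bound
    \<open>2 * P\<close>, which forces the maximizer within \<open>\<rho>\<close> of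
    \<open>z\<close>.\<close>
  define K where "K = (2 * P + 1) / \<rho>\<^sup>2"
  have "0 \<le> P" using P[of 0 z] \<open>0 \<le> t\<close> by auto
  then have "0 < K" using \<rho> by (simp add: K_def)
  have "continuous_on (UNIV \<times> {0..}) (\<lambda>z'. (case z' of (x, t) \<Rightarrow> u x t) - K * (dist (fst z') z)\<^sup>2)"
    by (intro continuous_on_diff cont continuous_intros)
  then have wcont: "continuous_on (UNIV \<times> {0..}) (\<lambda>(x, t). u x t - K * (dist x z)\<^sup>2)"
    by (simp add: case_prod_beta')
  obtain \<theta> \<theta>' t0 x0 where \<theta>: "\<And>t. (\<theta> has_real_derivative \<theta>' t) (at t)" "continuous_on UNIV \<theta>'"
    "mono \<theta>" "\<And>t. 0 \<le> \<theta> t" "\<And>s. s \<le> t \<Longrightarrow> \<theta> s = 0" and t0: "0 \<le> t0" "t0 < t + 1"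
    and max: "\<And>x s. 0 \<le> s \<Longrightarrow> s \<le> t + 1 \<Longrightarrow>
      u x s - K * (dist x z)\<^sup>2 - \<theta> s \<le> u x0 t0 - K * (dist x0 z)\<^sup>2 - \<theta> t0"
    by (rule penalized_max_exists[OF \<open>0 \<le> t\<close> wcont]) (rule that)
  have val: "u z t + K * (dist x0 z)\<^sup>2 + \<theta> t0 \<le> u x0 t0"
    using max[of t z] \<theta>(5)[of t] \<open>0 \<le> t\<close> by simp
  then have "K * (dist x0 z)\<^sup>2 \<le> 2 * P"
    using \<theta>(4)[of t0] P[of t z] P[of t0 x0] t0 \<open>0 \<le> t\<close> by auto
  also have "\<dots> < K * \<rho>\<^sup>2"
    using \<rho> by (simp add: K_def)
  finally have "(dist x0 z)\<^sup>2 < \<rho>\<^sup>2"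
    using \<open>0 < K\<close> by simp
  then have "dist x0 z < \<rho>"
    using \<rho> power_less_imp_less_base[of "dist x0 z" 2 \<rho>] by simp
  then have x0: "u x0 0 < u z 0 + \<sigma>" "f x0 < \<kappa>"
    using \<rho>1(2)[of x0] \<rho>2(2)[of x0] f(2) by (auto simp: \<rho>_def dist_real_def)
  have "0 \<le> K * (dist x0 z)\<^sup>2" using \<open>0 < K\<close> by simp
  then have ux0: "u z 0 + 2 * \<sigma> \<le> u x0 t0"
    using val \<theta>(4)[of t0] \<sigma>(2) by linarith
  then have "0 < t0" using x0 \<sigma> t0 by (cases "t0 = 0") auto
  obtain p where "norm p = 0 + 2 * K * dist x0 z"
    "\<sigma> * ((t0 - 0) powr (- \<alpha>) / \<alpha>) - 2 * 0 * ((t0 - 0) powr (1 - \<alpha>) / (1 - \<alpha>)) + H x0 p \<le> 0"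
  proof (rule subsolution_barrier_estimate[OF sub alpha \<theta>(1), of 0 0 t0 "t + 1" 0 K x0 z 0 \<sigma>])
    show "continuous_on {0<..} \<theta>'" using \<theta>(2) continuous_on_subset by blast
    show "- 0 * (t0 - s) \<le> \<theta> t0 - \<theta> s" if "s \<le> t0" for s
      using monoD[OF \<theta>(3) that] by simp
    show "\<sigma> \<le> u x0 t0 - past_extension (u x0) s" if "s \<le> 0" for s
      using that ux0 x0 by (auto simp: past_extension_def)
  qed (use \<open>0 < t0\<close> t0 \<open>0 < K\<close> max in auto)
  moreover have "\<kappa> \<le> \<sigma> * (t0 powr (- \<alpha>) / \<alpha>)"
    unfolding \<kappa>_def using \<sigma> alpha t0 \<open>0 < t0\<close>
    by (intro mult_left_mono divide_right_mono powr_mono2') auto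
  ultimately show False
    using H[of x0 p] x0 by simp
qed

text \<open>Away from its vertex the cone is a strict stationary supersolution, its touching
  gradients having norm \<open>K\<close>; the vertex is covered by the assumed bound at
  \<open>z\<close>.\<close>

lemma subsolution_le_cone:
  fixes u :: "'n::finite torus \<Rightarrow> real \<Rightarrow> real"
  assumes sub: "viscosity_subsolution \<alpha> H u" and alpha: "0 < \<alpha>" "\<alpha> < 1"
    and K: "0 \<le> K" and H: "\<And>x p. norm p = K \<Longrightarrow> 0 < H x p"
    and initial: "\<And>x. u x 0 \<le> c + K * dist x z"
    and vertex: "\<And>t. 0 \<le> t \<Longrightarrow> u z t \<le> c" and "0 \<le> t"
  shows "u x t \<le> c + K * dist x z"
proof (rule ccontr)
  assume neg: "\<not> u x t \<le> c + K * dist x z"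
  have cont: "continuous_on (UNIV \<times> {0..}) (\<lambda>(x, t). u x t)"
    using sub by (simp add: viscosity_subsolution_def)
  have "continuous_on (UNIV \<times> {0..}) (\<lambda>z'. (case z' of (x, t) \<Rightarrow> u x t) - K * dist (fst z') z)"
    by (intro continuous_on_diff cont continuous_intros)
  then have wcont: "continuous_on (UNIV \<times> {0..}) (\<lambda>(x, t). u x t - K * dist x z)"
    by (simp add: case_prod_beta')
  obtain \<theta> \<theta>' t0 x0 where \<theta>: "\<And>t. (\<theta> has_real_derivative \<theta>' t) (at t)" "continuous_on UNIV \<theta>'"
    "mono \<theta>" "\<And>t. 0 \<le> \<theta> t" "\<And>s. s \<le> t \<Longrightarrow> \<theta> s = 0" and t0: "0 \<le> t0" "t0 < t + 1"
    and max: "\<And>x s. 0 \<le> s \<Longrightarrow> s \<le> t + 1 \<Longrightarrow>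
      u x s - K * dist x z - \<theta> s \<le> u x0 t0 - K * dist x0 z - \<theta> t0"
    by (rule penalized_max_exists[OF \<open>0 \<le> t\<close> wcont]) (rule that)
  have val: "c + K * dist x0 z < u x0 t0"
    using max[of t x] \<theta>(4)[of t0] \<theta>(5)[of t] \<open>0 \<le> t\<close> neg by simp
  then have "x0 \<noteq> z" using vertex[OF t0(1)] by auto
  have "0 < t0" using val initial[of x0] t0 by (cases "t0 = 0") auto
  obtain p where p: "norm p = K + 2 * 0 * dist x0 z"
    "0 * ((t0 - 0) powr (- \<alpha>) / \<alpha>) - 2 * 0 * ((t0 - 0) powr (1 - \<alpha>) / (1 - \<alpha>)) + H x0 p \<le> 0"
  proof (rule subsolution_barrier_estimate[OF sub alpha \<theta>(1), of 0 0 t0 "t + 1" K 0 x0 z 0 0])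
    show "continuous_on {0<..} \<theta>'" using \<theta>(2) continuous_on_subset by blast
    show "- 0 * (t0 - s) \<le> \<theta> t0 - \<theta> s" if "s \<le> t0" for s
      using monoD[OF \<theta>(3) that] by simp
    \<comment> \<open>Maximality compared with time 0 at the same point gives the constant past a
      favourable sign.\<close>
    show "0 \<le> u x0 t0 - past_extension (u x0) s" if "s \<le> 0" for s
      using that max[of 0 x0] monoD[OF \<theta>(3) t0(1)] \<open>0 \<le> t\<close> by (auto simp: past_extension_def)
  qed (use \<open>0 < t0\<close> t0 K max \<open>x0 \<noteq> z\<close> in auto)
  then show False using H[of p x0] by simp
qed

section \<open>Propagation along curves in the zero set\<close>

lemma exists_small_caputo_window:
  fixes \<alpha> B \<eta> :: real
  assumes "0 < \<alpha>" "0 < \<eta>"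
  obtains V where "0 < V" "B * V powr (- \<alpha>) < \<eta>"
proof -
  have "((\<lambda>V::real. B * V powr (- \<alpha>)) \<longlongrightarrow> B * 0) at_top"
    using assms by (intro tendsto_mult tendsto_const tendsto_neg_powr filterlim_ident) auto
  then have "\<forall>\<^sub>F V::real in at_top. B * V powr (- \<alpha>) < \<eta>"
    using assms by (auto intro: order_tendstoD)
  with eventually_gt_at_top[of 0] have "\<forall>\<^sub>F V::real in at_top. 0 < V \<and> B * V powr (- \<alpha>) < \<eta>"
    by eventually_elim simp
  then show thesis
    using that eventually_happens'[OF trivial_limit_at_top_linorder] by blast
qed

text \<open>The quadratic part of the barrier reaches the oscillation \<open>B\<close> at distance \<open>R\<close>, and a time
  penalty of amplitude \<open>B\<close> and width \<open>V\<close> costs only \<open>O(V\<^sup>-\<^sup>\<alpha>)\<close> in the Caputo derivative, so the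
  maximum can sit only over \<open>z\<close>.\<close>

lemma subsolution_propagates_upper_bound:
  fixes u :: "'n::finite torus \<Rightarrow> real \<Rightarrow> real"
  assumes sub: "viscosity_subsolution \<alpha> H u" and alpha: "0 < \<alpha>" "\<alpha> < 1"
    and bounds: "\<And>x t. 0 \<le> t \<Longrightarrow> m \<le> u x t" "\<And>x t. 0 \<le> t \<Longrightarrow> u x t \<le> m + B"
    and pos: "0 < B" "0 < \<epsilon>" "0 < \<eta>" "0 < R"
    and H: "\<And>x p. dist x z < R \<Longrightarrow> \<epsilon> \<le> norm p \<Longrightarrow> \<eta> \<le> H x p"
    and L: "\<forall>\<^sub>F t in at_top. u z t \<le> L"
  shows "\<forall>\<^sub>F t in at_top. u y t \<le> L + (\<epsilon> * dist y z + B / R\<^sup>2 * (dist y z)\<^sup>2)"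
proof -
  obtain S0 where S0: "\<And>t. S0 \<le> t \<Longrightarrow> u z t \<le> L"
    using L by (auto simp: eventually_at_top_linorder)
  define S where "S = max 0 S0"
  have S: "0 \<le> S" "\<And>t. S \<le> t \<Longrightarrow> u z t \<le> L"
    using S0 by (auto simp: S_def)
  have "m \<le> L" using bounds(1)[of S z] S(2)[of S] S(1) by simp
  define M where "M = B / R\<^sup>2"
  have M: "0 < M" using pos by (simp add: M_def)
  define q where "q x = \<epsilon> * dist x z + M * (dist x z)\<^sup>2" for x
  have q0: "0 \<le> q x" for x using pos M by (simp add: q_def)
  \<comment> \<open>The first term comes from increments at least \<open>- B\<close> over the remote
    past, the second from twice the slope \<open>3 * B / V\<close> times
    \<open>V powr (1 - \<alpha>) / (1 - \<alpha>)\<close>.\<close>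
  obtain V where V: "0 < V" "(B / \<alpha> + 6 * B / (1 - \<alpha>)) * V powr (- \<alpha>) < \<eta>"
    using exists_small_caputo_window[OF alpha(1) pos(3)] by blast
  \<comment> \<open>The threshold places the whole window of half-width \<open>2 * V\<close> around
    \<open>T\<close> after \<open>S\<close>.\<close>
  have "u y T \<le> L + q y" if T: "S + 2 * V \<le> T" for T
  proof (rule ccontr)
    assume neg: "\<not> u y T \<le> L + q y"
    \<comment> \<open>The penalty equals \<open>B\<close> at distance \<open>V\<close> from
      \<open>T\<close>, so the maximizer is closer than \<open>V\<close>; half-width
      \<open>2 * V\<close> leaves room for the memory interval from \<open>t0 - V\<close> to
      \<open>t0\<close>.\<close>
    define \<theta> where "\<theta> t = B * ((t - T) / V)\<^sup>2" for t
    define \<theta>' where "\<theta>' t = 2 * B * (t - T) / V\<^sup>2" for t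
    have d\<theta>: "(\<theta> has_real_derivative \<theta>' t) (at t)" for t
      unfolding \<theta>_def \<theta>'_def
      using V by (auto intro!: derivative_eq_intros simp: power2_eq_square)
    have c\<theta>: "continuous_on A \<theta>" "continuous_on A \<theta>'" for A
      unfolding \<theta>_def \<theta>'_def by (intro continuous_intros; use V in simp)+
    let ?K = "(UNIV :: 'n torus set) \<times> {T - 2 * V..T + 2 * V}"
    have K: "compact ?K" "?K \<noteq> {}"
      using V by (auto intro: compact_Times compact_torus)
    have "continuous_on (UNIV \<times> {0..}) (\<lambda>(x, t). u x t)"
      using sub by (simp add: viscosity_subsolution_def)
    then have uK: "continuous_on ?K (\<lambda>(x, t). u x t)"
      by (rule continuous_on_subset) (use T S in auto)
    have qK: "continuous_on ?K (\<lambda>z. q (fst z))"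
      unfolding q_def by (intro continuous_intros)
    have "continuous_on ?K (\<lambda>z. \<theta> (snd z))"
      by (rule continuous_on_compose2[OF c\<theta>(1)[of UNIV] continuous_on_snd[OF continuous_on_id]]) auto
    from continuous_attains_sup[OF K continuous_on_diff[OF continuous_on_diff[OF uK qK] this]]
    obtain x0 t0 where t0: "T - 2 * V \<le> t0" "t0 \<le> T + 2 * V"
      and max: "\<And>x t. T - 2 * V \<le> t \<Longrightarrow> t \<le> T + 2 * V \<Longrightarrow>
        u x t - q x - \<theta> t \<le> u x0 t0 - q x0 - \<theta> t0"
      by force
    have t0S: "0 \<le> t0" "S \<le> t0" using t0 T S by auto
    have "L < u y T - q y - \<theta> T" using neg by (simp add: \<theta>_def)
    also have "\<dots> \<le> u x0 t0 - q x0 - \<theta> t0" using V by (intro max) auto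
    finally have val: "L < u x0 t0 - q x0 - \<theta> t0" .
    have \<theta>0: "0 \<le> \<theta> t" for t using pos by (simp add: \<theta>_def)
    have "q x0 < B" "\<theta> t0 < B"
      using val bounds(2)[OF t0S(1), of x0] \<open>m \<le> L\<close> q0[of x0] \<theta>0[of t0] by auto
    have "x0 \<noteq> z"
    proof
      assume "x0 = z"
      then show False using val S(2)[OF t0S(2)] q0[of x0] \<theta>0[of t0] by simp
    qed
    have "M * (dist x0 z)\<^sup>2 \<le> q x0"
      using pos by (simp add: q_def)
    also have "q x0 < M * R\<^sup>2"
      using \<open>q x0 < B\<close> pos by (simp add: M_def)
    finally have "(dist x0 z)\<^sup>2 < R\<^sup>2"
      using M by simp
    then have R: "dist x0 z < R"
      using pos power_less_imp_less_base[of "dist x0 z" 2 R] by simp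
    have "((t0 - T) / V)\<^sup>2 < 1"
      using \<open>\<theta> t0 < B\<close> pos by (simp add: \<theta>_def)
    then have "\<bar>(t0 - T) / V\<bar> < 1"
      by (simp only: abs_square_less_1)
    then have tV: "T - V < t0" "t0 < T + V"
      using V by (auto simp: abs_less_iff field_simps)
    \<comment> \<open>From \<open>t0 > T - V\<close> and \<open>s > T - 2 * V\<close> the factor
      \<open>t0 + s - 2 * T\<close> exceeds \<open>- 3 * V\<close>.\<close>
    have near: "- (3 * B / V) * (t0 - s) \<le> \<theta> t0 - \<theta> s" if s: "t0 - V \<le> s" "s \<le> t0" for s
    proof -
      have "\<theta> t0 - \<theta> s = B / V\<^sup>2 * (t0 - s) * (t0 + s - 2 * T)"
        using V by (simp add: \<theta>_def power_divide power2_eq_square divide_simps) (simp add: algebra_simps)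
      moreover have "B / V\<^sup>2 * (t0 - s) * (- 3 * V) \<le> B / V\<^sup>2 * (t0 - s) * (t0 + s - 2 * T)"
        using s pos V tV by (intro mult_left_mono mult_nonneg_nonneg) auto
      moreover have "B / V\<^sup>2 * (t0 - s) * (- 3 * V) = - (3 * B / V) * (t0 - s)"
        using V by (simp add: power2_eq_square field_simps)
      ultimately show ?thesis by simp
    qed
    have far: "- B \<le> u x0 t0 - past_extension (u x0) s" for s
      using bounds(1)[OF t0S(1), of x0] bounds(2)[of "max 0 s" x0]
      by (simp add: past_extension_eq_max)
    obtain p where p: "norm p = \<epsilon> + 2 * M * dist x0 z"
      "- B * ((t0 - (t0 - V)) powr (- \<alpha>) / \<alpha>)
        - 2 * (3 * B / V) * ((t0 - (t0 - V)) powr (1 - \<alpha>) / (1 - \<alpha>)) + H x0 p \<le> 0"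
    proof (rule subsolution_barrier_estimate[OF sub alpha d\<theta> c\<theta>(2),
          of "T - 2 * V" "t0 - V" t0 "T + 2 * V" \<epsilon> M x0 z "3 * B / V" "- B"])
      show "u x t - (\<epsilon> * dist x z + M * (dist x z)\<^sup>2) - \<theta> t
          \<le> u x0 t0 - (\<epsilon> * dist x0 z + M * (dist x0 z)\<^sup>2) - \<theta> t0"
        if "T - 2 * V \<le> t" "t \<le> T + 2 * V" for x t
        using max[OF that, of x] by (simp add: q_def)
    qed (use T S V tV pos M \<open>x0 \<noteq> z\<close> near far in auto)
    have "\<eta> \<le> H x0 p"
      using R M pos by (intro H) (auto simp: p)
    moreover have "V powr (1 - \<alpha>) = V * V powr (- \<alpha>)"
      using V powr_add[of V 1 "- \<alpha>"] by simp
    then have "2 * (3 * B / V) * (V powr (1 - \<alpha>) / (1 - \<alpha>)) = 6 * B / (1 - \<alpha>) * V powr (- \<alpha>)"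
      using V by simp
    ultimately show False
      using p(2) V(2) by (simp add: ring_distribs)
  qed
  then show ?thesis
    unfolding eventually_at_top_linorder q_def M_def by blast
qed

text \<open>Every link may delay the time from which the bound holds; over finitely many links the
  delays stay finite and the costs add up.\<close>

lemma eventually_le_along_chain:
  fixes y :: "nat \<Rightarrow> 'a::metric_space" and u :: "'a \<Rightarrow> real \<Rightarrow> real"
  assumes step: "\<And>z y L. z \<in> Z \<Longrightarrow> \<forall>\<^sub>F t in at_top. u z t \<le> L \<Longrightarrow>
      \<forall>\<^sub>F t in at_top. u y t \<le> L + w (dist y z)"
    and "\<And>i. i \<le> n \<Longrightarrow> y i \<in> Z" and "\<forall>\<^sub>F t in at_top. u (y 0) t \<le> L"
  shows "\<forall>\<^sub>F t in at_top. u (y n) t \<le> L + (\<Sum>i = 1..n. w (dist (y i) (y (i - 1))))"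
  using assms(2)
proof (induction n)
  case (Suc n)
  then have "\<forall>\<^sub>F t in at_top. u (y n) t \<le> L + (\<Sum>i = 1..n. w (dist (y i) (y (i - 1))))"
    by simp
  from step[OF _ this, of "y (Suc n)"] Suc.prems[of n] show ?case
    by (simp add: algebra_simps)
qed (use assms(3) in simp)

text \<open>By uniform continuity an equidistant partition is as fine as desired, and its sum is one
  of those below the supremum, so \<open>len\<close> is independent of \<open>e\<close>.\<close>

lemma rectifiable_curve_fine_partition:
  fixes \<gamma> :: "real \<Rightarrow> 'a::metric_space"
  assumes \<gamma>: "rectifiable_curve \<gamma>"
  obtains len where "0 \<le> len" "\<And>e. 0 < e \<Longrightarrow> \<exists>n t. t 0 = 0 \<and> t n = 1 \<and> (\<forall>i \<le> n. t i \<in> {0..1}) \<and>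
    (\<forall>i \<in> {1..n}. dist (\<gamma> (t i)) (\<gamma> (t (i - 1))) \<le> e) \<and>
    (\<Sum>i = 1..(n::nat). dist (\<gamma> (t i)) (\<gamma> (t (i - 1)))) \<le> len"
proof -
  have sums: "ereal (\<Sum>i = 1..n. dist (\<gamma> (t i)) (\<gamma> (t (i - 1)))) \<le> curve_length \<gamma>"
    if "n \<ge> 1" "t 0 = 0" "t n = 1" "\<forall>i\<in>{1..n}. t (i - 1) < t i" for n and t :: "nat \<Rightarrow> real"
    unfolding curve_length_def using that by (intro Sup_upper) blast
  \<comment> \<open>The one-piece partition excludes the value -\<infinity>, so the length is a real
    number.\<close>
  have "0 \<le> ereal (\<Sum>i = 1..1. dist (\<gamma> (real i)) (\<gamma> (real (i - 1))))"
    by simp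
  also have "\<dots> \<le> curve_length \<gamma>"
    by (rule sums) auto
  finally obtain len where len: "curve_length \<gamma> = ereal len" "0 \<le> len"
    using \<gamma> unfolding rectifiable_curve_def by (cases "curve_length \<gamma>") auto
  show thesis
  proof (rule that[OF len(2)])
    fix e :: real assume "0 < e"
    have "uniformly_continuous_on {0..1} \<gamma>"
      using \<gamma> by (intro compact_uniformly_continuous) (auto simp: rectifiable_curve_def)
    then obtain d where d: "0 < d"
      "\<And>s t. s \<in> {0..1} \<Longrightarrow> t \<in> {0..1} \<Longrightarrow> dist t s < d \<Longrightarrow> dist (\<gamma> t) (\<gamma> s) < e"
      using \<open>0 < e\<close> unfolding uniformly_continuous_on_def by metis
    obtain n where n: "inverse (real (Suc n)) < d"
      using reals_Archimedean[OF d(1)] by blast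
    define N where "N = Suc n"
    define t where "t i = real i / real N" for i
    have N: "N \<ge> 1" "1 / real N < d" using n by (auto simp: N_def inverse_eq_divide)
    have t: "t 0 = 0" "t N = 1" using N by (auto simp: t_def)
    have t01: "t i \<in> {0..1}" if "i \<le> N" for i
      using that N by (auto simp: t_def divide_le_eq)
    have diff: "t i - t (i - 1) = 1 / real N" if "i \<in> {1..N}" for i
      using that N by (auto simp: t_def diff_divide_distrib[symmetric] of_nat_diff)
    have "dist (\<gamma> (t i)) (\<gamma> (t (i - 1))) \<le> e" if i: "i \<in> {1..N}" for i
      using d(2)[of "t (i - 1)" "t i"] t01[of i] t01[of "i - 1"] i diff[OF i] N
      by (auto simp: dist_real_def less_imp_le)
    moreover have "t (i - 1) < t i" if "i \<in> {1..N}" for i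
    proof -
      have "0 < 1 / real N" using N by simp
      then show ?thesis using diff[OF that] by linarith
    qed
    then have "(\<Sum>i = 1..N. dist (\<gamma> (t i)) (\<gamma> (t (i - 1)))) \<le> len"
      using sums[of N t] N t by (simp add: len)
    ultimately show "\<exists>n t. t 0 = 0 \<and> t n = 1 \<and> (\<forall>i \<le> n. t i \<in> {0..1}) \<and>
      (\<forall>i \<in> {1..n}. dist (\<gamma> (t i)) (\<gamma> (t (i - 1))) \<le> e) \<and>
      (\<Sum>i = 1..(n::nat). dist (\<gamma> (t i)) (\<gamma> (t (i - 1)))) \<le> len"
      using t t01 by blast
  qed
qed

section \<open>Attained minima, uniform positivity of \<open>F\<close>, and convergence on the zero
  set\<close>

lemma min_value_le:
  fixes g :: "'a::topological_space \<Rightarrow> real"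
  assumes "compact (UNIV :: 'a set)" "continuous_on UNIV g"
  shows "min_value g \<le> g x"
proof -
  \<comment> \<open>\<open>LEAST\<close> on the reals is meaningful once the minimum is attained,
    which compactness provides.\<close>
  obtain x0 where x0: "\<forall>y. g x0 \<le> g y"
    using continuous_attains_inf[OF assms(1) _ assms(2)] by auto
  have "min_value g = g x0"
    unfolding min_value_def by (rule Least_equality) (use x0 in auto)
  with x0 show ?thesis by simp
qed

text \<open>Shrinking \<open>p\<close> to a small sphere inside the ball and using convexity with
  \<open>F x 0 = 0\<close> carries the local power bound out to all larger \<open>p\<close>,
  uniformly in \<open>x\<close>.\<close>

lemma convex_uniform_positivity:
  fixes F :: "'x \<Rightarrow> 'v::real_normed_vector \<Rightarrow> real"
  assumes convex: "\<And>x. convex_on UNIV (F x)" and zero: "\<And>x. F x 0 = 0"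
    and F_pos: "\<And>x p. p \<noteq> 0 \<Longrightarrow> F x p > F x 0"
    and lower: "\<And>x p. p \<in> ball 0 r \<Longrightarrow> F x p \<ge> \<nu> * norm p powr k"
    and pos: "0 < r" "0 < \<nu>" "0 < \<epsilon>"
  obtains \<eta> where "0 < \<eta>" "\<And>x p. \<epsilon> \<le> norm p \<Longrightarrow> \<eta> \<le> F x p"
proof -
  define e where "e = min \<epsilon> (r / 2)"
  have e: "0 < e" "e \<le> \<epsilon>" "e < r" using pos by (auto simp: e_def)
  show thesis
  proof
    show "0 < \<nu> * e powr k" using pos e by simp
    fix x and p :: 'v assume p: "\<epsilon> \<le> norm p"
    have "p \<noteq> 0" using p pos by auto
    define l where "l = e / norm p"
    have l: "0 \<le> l" "l \<le> 1" using e p by (auto simp: l_def divide_le_eq)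
    have nl: "norm (l *\<^sub>R p) = e" using e \<open>p \<noteq> 0\<close> by (simp add: l_def)
    have "\<nu> * e powr k \<le> F x (l *\<^sub>R p)"
      using lower[of "l *\<^sub>R p" x] nl e by simp
    also have "F x (l *\<^sub>R p) \<le> l * F x p"
      using convex_onD[OF convex[of x] l, of 0 p] by (simp add: zero)
    also have "\<dots> \<le> F x p"
      using l F_pos[OF \<open>p \<noteq> 0\<close>, of x] zero[of x] by (intro mult_left_le_one_le) auto
    finally show "\<nu> * e powr k \<le> F x p" .
  qed
qed

theorem theorem4p3:
  fixes \<alpha> :: real
    and g f :: "'n::finite torus \<Rightarrow> real"
    and F H :: "'n torus \<Rightarrow> real ^ 'n \<Rightarrow> real"
    and u :: "'n torus \<Rightarrow> real \<Rightarrow> real"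
  assumes alpha: "0 < \<alpha>" "\<alpha> < 1"
    and g_lipschitz: "\<exists>L. L-lipschitz_on UNIV g"
    and H_eq: "\<And>x p. H x p = F x p - f x"
    and F_cont: "continuous_on UNIV (\<lambda>(x, p). F x p)"
    and f_cont: "continuous_on UNIV f"
    and F_convex: "\<And>x. convex_on UNIV (F x)"
    and F_zero: "\<And>x. F x 0 = 0"
    and F_pos: "\<And>x p. p \<noteq> 0 \<Longrightarrow> F x p > F x 0"
    and f_nonneg: "\<And>x. f x \<ge> 0"
    and f_lipschitz: "\<exists>L. L-lipschitz_on UNIV f"
    and f_min: "min_value f = 0"
    and F_coercive: "\<exists>C m :: real. C > 1 \<and> m \<ge> 1 \<and>
      (\<forall>x p. F x p \<ge> inverse C * norm p powr m - C)"
    and H_structure: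
      "(\<exists>c > 0. \<forall>x y p. \<bar>H x p - H y p\<bar> \<le> c * (1 + norm p) * dist x y) \<or>
       (\<exists>m' A c :: real. m' > 1 \<and> A > 0 \<and> c > 1 \<and>
         (\<forall>\<mu> x y p. 0 < \<mu> \<longrightarrow> \<mu> < 1 \<longrightarrow>
           \<mu> * H x (inverse \<mu> *\<^sub>R p) - H x p \<ge> (1 - \<mu>) * (inverse c * norm p powr m' - A) \<and>
           \<bar>H x p - H y p\<bar> \<le> c * (1 + norm p powr m') * dist x y))"
    and F_lower: "\<exists>\<nu> r k :: real. \<nu> > 0 \<and> r > 0 \<and> k \<ge> 1 \<and>
      (\<forall>x. \<forall>p \<in> ball 0 r. F x p \<ge> \<nu> * norm p powr k)"
    and argmin_meets: "argmin g \<inter> argmin f \<noteq> {}"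
    and curves: "\<And>z. z \<in> argmin f \<Longrightarrow>
      \<exists>x0 \<in> argmin f \<inter> argmin g. \<exists>\<gamma> :: real \<Rightarrow> 'n torus.
        rectifiable_curve \<gamma> \<and> \<gamma> 0 = x0 \<and> \<gamma> 1 = z \<and> (\<forall>t \<in> {0..1}. \<gamma> t \<in> argmin f)"
    and u_solution: "viscosity_solution \<alpha> H u"
    and u_initial: "\<And>x. u x 0 = g x"
  shows "\<forall>x \<in> argmin f. ((\<lambda>t. u x t) \<longlongrightarrow> min_value g) at_top"
proof
  fix z assume z: "z \<in> argmin f"
  have sub: "viscosity_subsolution \<alpha> H u" and super: "viscosity_supersolution \<alpha> H u"
    using u_solution by (simp_all add: viscosity_solution_def)
  have F_nonneg: "0 \<le> F x p" for x p
    using F_pos[of p x] F_zero[of x] by (cases "p = 0") auto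
  have Z: "f x = 0" if "x \<in> argmin f" for x
    using that f_min by (simp add: argmin_def)
  define m where "m = min_value g"
  obtain Lg where Lg: "Lg-lipschitz_on UNIV g" using g_lipschitz by blast
  obtain Lf where Lf: "Lf-lipschitz_on UNIV f" using f_lipschitz by blast
  have g_ge: "m \<le> g x" for x
    unfolding m_def by (rule min_value_le[OF compact_torus lipschitz_on_continuous_on[OF Lg]])
  have lower: "m \<le> u x t" if "0 \<le> t" for x t
    by (rule supersolution_ge_initial_min[OF super alpha _ _ that])
      (use f_nonneg g_ge in \<open>auto simp: H_eq F_zero u_initial\<close>)
  have at_Z: "u x t \<le> g x" if "x \<in> argmin f" "0 \<le> t" for x t
    using subsolution_le_initial_at_zero[OF sub alpha _ f_cont Z[OF that(1)] that(2)] F_nonneg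
    by (simp add: H_eq u_initial)
  obtain D where D: "\<And>x y :: 'n torus. dist x y \<le> D"
    using compact_imp_bounded[OF compact_torus] bounded_two_points[of UNIV] by auto
  \<comment> \<open>The bound uniform in time comes from a cone with vertex at a common point of
    both argmin sets, where \<open>u\<close> never exceeds \<open>m\<close>.\<close>
  obtain B where B: "0 < B" "\<And>x t. 0 \<le> t \<Longrightarrow> u x t \<le> m + B"
  proof -
    obtain x1 where x1: "x1 \<in> argmin g" "x1 \<in> argmin f" using argmin_meets by blast
    have gx1: "g x1 = m" using x1 by (simp add: argmin_def m_def)
    obtain C e where C: "C > 1" "e \<ge> 1" "\<And>x p. F x p \<ge> inverse C * norm p powr e - C"
      using F_coercive by blast
    define Q where "Q = Lf * D"
    have f_le: "f x \<le> Q" for x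
    proof -
      have "f x \<le> Lf * dist x x1"
        using lipschitz_onD[OF Lf, of x x1] Z[OF x1(2)] by (simp add: dist_real_def)
      also have "\<dots> \<le> Q"
        unfolding Q_def using D lipschitz_on_nonneg[OF Lf] by (intro mult_left_mono)
      finally show ?thesis .
    qed
    \<comment> \<open>\<open>Lg\<close> puts the initial datum below the cone, the last term lets
      coercivity beat \<open>f x \<le> Q\<close> on the sphere of radius \<open>K\<close>, and
      \<open>1 \<le> K\<close> gives \<open>K \<le> K powr e\<close>.\<close>
    define K where "K = max 1 (max Lg (C * (C + Q + 1)))"
    have K: "1 \<le> K" "Lg \<le> K" "C * (C + Q + 1) \<le> K" by (auto simp: K_def)
    have cone: "u x t \<le> m + K * dist x x1" if "0 \<le> t" for x t
    proof (rule subsolution_le_cone[OF sub alpha _ _ _ _ that])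
      show "0 \<le> K" using K by simp
      show "0 < H x p" if p: "norm p = K" for x p
      proof -
        have "K powr 1 \<le> K powr e" using K C by (intro powr_mono) auto
        then have "C * (C + Q + 1) \<le> K powr e" using K by simp
        then have "C + Q + 1 \<le> inverse C * K powr e" using C by (simp add: field_simps)
        then show ?thesis using C(3)[of p x] f_le[of x] p by (simp add: H_eq)
      qed
      show "u x 0 \<le> m + K * dist x x1" for x
      proof -
        have "g x \<le> m + Lg * dist x x1"
          using lipschitz_onD[OF Lg, of x x1] by (simp add: dist_real_def gx1)
        also have "Lg * dist x x1 \<le> K * dist x x1" using K by (intro mult_right_mono) auto
        finally show ?thesis by (simp add: u_initial)
      qed
      show "u x1 t \<le> m" if "0 \<le> t" for t
        using at_Z[OF x1(2) that] gx1 by simp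
    qed
    show thesis
    proof (rule that[of "K * D + 1"])
      have "0 \<le> D" using D[of x1 x1] by simp
      then show "0 < K * D + 1" using K by (simp add: add_nonneg_pos)
      fix x t assume "0 \<le> (t::real)"
      have "K * dist x x1 \<le> K * D" using K D by (intro mult_left_mono) auto
      then show "u x t \<le> m + (K * D + 1)" using cone[OF \<open>0 \<le> t\<close>, of x] by simp
    qed
  qed
  obtain x0 \<gamma> where x0: "x0 \<in> argmin f" "x0 \<in> argmin g"
    and \<gamma>: "rectifiable_curve \<gamma>" "\<gamma> 0 = x0" "\<gamma> 1 = z" "\<And>t. t \<in> {0..1} \<Longrightarrow> \<gamma> t \<in> argmin f"
    using curves[OF z] by blast
  obtain len where len: "0 \<le> len" "\<And>e. 0 < e \<Longrightarrow> \<exists>n t. t 0 = 0 \<and> t n = 1 \<and> (\<forall>i \<le> n. t i \<in> {0..1}) \<and>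
    (\<forall>i \<in> {1..n}. dist (\<gamma> (t i)) (\<gamma> (t (i - 1))) \<le> e) \<and>
    (\<Sum>i = 1..(n::nat). dist (\<gamma> (t i)) (\<gamma> (t (i - 1)))) \<le> len"
    by (rule rectifiable_curve_fine_partition[OF \<gamma>(1)]) (rule that)
  have upper: "\<forall>\<^sub>F t in at_top. u z t \<le> m + 2 * \<epsilon> * len" if "0 < \<epsilon>" for \<epsilon>
  proof -
    obtain \<nu> r k where F_low: "\<nu> > 0" "r > 0"
      "\<And>x p. p \<in> ball 0 r \<Longrightarrow> F x p \<ge> \<nu> * norm p powr k"
      using F_lower by blast
    obtain \<eta> where \<eta>: "0 < \<eta>" "\<And>x p. \<epsilon> \<le> norm p \<Longrightarrow> \<eta> \<le> F x p"
      using convex_uniform_positivity[of F r \<nu> k \<epsilon>, OF F_convex F_zero F_pos F_low(3,2,1) \<open>0 < \<epsilon>\<close>]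
      by blast
    \<comment> \<open>Within \<open>R\<close> of any zero, \<open>f\<close> is at most
      \<open>\<eta> / 2\<close>; adding 1 avoids division by 0. As \<open>R\<close> is independent
      of the zero, one barrier serves the whole curve.\<close>
    define R where "R = \<eta> / (2 * (Lf + 1))"
    have Lf0: "0 \<le> Lf" by (rule lipschitz_on_nonneg[OF Lf])
    then have R: "0 < R" using \<eta> by (simp add: R_def)
    have H_low: "\<eta> / 2 \<le> H x p" if "y \<in> argmin f" "dist x y < R" "\<epsilon> \<le> norm p" for x y p
    proof -
      have "f x \<le> Lf * dist x y"
        using lipschitz_onD[OF Lf, of x y] Z[OF that(1)] by (simp add: dist_real_def)
      also have "\<dots> \<le> (Lf + 1) * R"
        using that Lf0 by (intro mult_mono) auto
      also have "\<dots> = \<eta> / 2" using Lf0 by (simp add: R_def divide_simps)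
      finally show ?thesis using \<eta>(2)[OF that(3), of x] by (simp add: H_eq)
    qed
    define M where "M = B / R\<^sup>2"
    have M: "0 < M" using B R by (simp add: M_def)
    define w where "w d = \<epsilon> * d + M * d\<^sup>2" for d
    \<comment> \<open>On links of length \<open>d\<close> at most \<open>\<epsilon> / M\<close> the
      quadratic cost is below the linear one, so a link costs at most
      \<open>2 * \<epsilon> * d\<close>.\<close>
    have "0 < \<epsilon> / M" using M \<open>0 < \<epsilon>\<close> by simp
    from len(2)[OF this] obtain n t where t: "t 0 = 0" "t n = 1" "\<And>i. i \<le> n \<Longrightarrow> t i \<in> {0..1}"
      "\<And>i. i \<in> {1..n} \<Longrightarrow> dist (\<gamma> (t i)) (\<gamma> (t (i - 1))) \<le> \<epsilon> / M"
      "(\<Sum>i = 1..(n::nat). dist (\<gamma> (t i)) (\<gamma> (t (i - 1)))) \<le> len"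
      by blast
    have "\<forall>\<^sub>F s in at_top. u (\<gamma> (t n)) s \<le> m + (\<Sum>i = 1..n. w (dist (\<gamma> (t i)) (\<gamma> (t (i - 1)))))"
    proof (rule eventually_le_along_chain[where Z = "argmin f" and y = "\<lambda>i. \<gamma> (t i)"])
      show "\<forall>\<^sub>F s in at_top. u y s \<le> L + w (dist y y')"
        if "y' \<in> argmin f" "\<forall>\<^sub>F s in at_top. u y' s \<le> L" for y y' L
        unfolding w_def M_def
        by (rule subsolution_propagates_upper_bound[OF sub alpha lower B(2,1) \<open>0 < \<epsilon>\<close> _ R H_low[OF that(1)] that(2)])
          (use \<eta> in auto)
      show "\<forall>\<^sub>F s in at_top. u (\<gamma> (t 0)) s \<le> m"
        using eventually_ge_at_top[of 0]
      proof eventually_elim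
        case (elim s)
        then show ?case
          using at_Z[OF x0(1), of s] x0(2) by (simp add: t \<gamma> argmin_def m_def)
      qed
    qed (use \<gamma>(4) t(3) in auto)
    moreover have "(\<Sum>i = 1..n. w (dist (\<gamma> (t i)) (\<gamma> (t (i - 1))))) \<le> 2 * \<epsilon> * len"
    proof -
      have "(\<Sum>i = 1..n. w (dist (\<gamma> (t i)) (\<gamma> (t (i - 1)))))
          \<le> (\<Sum>i = 1..n. 2 * \<epsilon> * dist (\<gamma> (t i)) (\<gamma> (t (i - 1))))"
      proof (rule sum_mono)
        fix i assume i: "i \<in> {1..n}"
        let ?d = "dist (\<gamma> (t i)) (\<gamma> (t (i - 1)))"
        have "M * ?d \<le> \<epsilon>" using t(4)[OF i] M by (simp add: field_simps)
        then have "M * ?d * ?d \<le> \<epsilon> * ?d" by (intro mult_right_mono) auto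
        then show "w ?d \<le> 2 * \<epsilon> * ?d" by (simp add: w_def power2_eq_square)
      qed
      also have "\<dots> \<le> 2 * \<epsilon> * len"
        unfolding sum_distrib_left[symmetric] using t(5) that by (intro mult_left_mono) auto
      finally show ?thesis .
    qed
    ultimately show ?thesis
      by (auto simp: t(2) \<gamma>(3) elim!: eventually_mono)
  qed
  show "((\<lambda>t. u z t) \<longlongrightarrow> min_value g) at_top"
    unfolding m_def[symmetric]
  proof (rule order_tendstoI)
    show "\<forall>\<^sub>F t in at_top. a < u z t" if "a < m" for a
      using eventually_ge_at_top[of 0] by eventually_elim (rule less_le_trans[OF that lower])
    show "\<forall>\<^sub>F t in at_top. u z t < a" if "m < a" for a
    proof -
      \<comment> \<open>Using \<open>len + 1\<close> covers curves of length 0 and makes the final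
        inequality strict.\<close>
      define \<epsilon> where "\<epsilon> = (a - m) / (2 * (len + 1))"
      have "0 < \<epsilon>" using that len(1) by (simp add: \<epsilon>_def)
      moreover have "2 * \<epsilon> * (len + 1) = a - m" using len(1) by (simp add: \<epsilon>_def field_simps)
      ultimately have "m + 2 * \<epsilon> * len < a" by (simp add: ring_distribs)
      with upper[OF \<open>0 < \<epsilon>\<close>] show ?thesis by (auto elim!: eventually_mono)
    qed
  qed
qed

end
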